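(* Let $G$ be a locally dual polar graph. Then the $1$--skeleton $\widetilde G$ of the universal cover of the triangle-square complex of $G$ is a dual polar graph. If, moreover, $G$ is locally finite, then $\widetilde G$ is a finite dual polar graph.
   Context: Graphs are simple, undirected, connected, possibly infinite; $d$ is graph distance, $I(u,v)=\{x:d(u,x)+d(x,v)=d(u,v)\}$. $G$ is thick if for every $u,v$ with $d(u,v)=2$ the interval $I(u,v)$ contains an induced $4$--cycle. Locally weakly modular: for every $u$, (LTC) for adjacent $v,w$ with $d(u,v)=d(u,w)=2$ there is a common neighbor of $u,v,w$, and (LQC) for $v,w,z$ with $z\sim v,w$, $d(v,w)=d(u,v)=d(u,w)=d(u,z)-1=2$ there is a common neighbor of $u,v,w$. A graph is locally dual polar if it is thick, locally weakly modular, and contains no induced $K_4^-$ and no isometric $K_{3,3}^-$ ($K_4$, resp. $K_{3,3}$, minus an edge). A subgraph is gated if each vertex $x$ has $x'$ in it with $x'\in I(x,y)$ for all $y$ in it; the gated hull is the smallest gated set containing a given set. A dual polar graph is a graph in which (A1) every maximal clique is gated; (A3\&4) the gated hull of two vertices at distance $2$ has diameter $2$; (A5) for nonadjacent $u,v$ and any neighbor $x$ of $u$ in $I(u,v)$ there is a neighbor $y$ of $v$ in $I(u,v)$ with $d(u,v)=d(x,y)=d(u,y)+1=d(x,v)+1$. The triangle-square complex is the $2$--complex with $1$--skeleton $G$ and $2$--cells glued along all $3$--cycles and induced $4$--cycles; the universal cover is its simply connected covering space. *)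

theory Defs
  imports Main
begin

definition graph :: "'a set \<Rightarrow> ('a \<Rightarrow> 'a \<Rightarrow> bool) \<Rightarrow> bool" where
  "graph V E \<longleftrightarrow> (\<forall>x y. E x y \<longrightarrow> x \<in> V \<and> y \<in> V \<and> E y x \<and> x \<noteq> y)"

definition walk :: "'a set \<Rightarrow> ('a \<Rightarrow> 'a \<Rightarrow> bool) \<Rightarrow> 'a list \<Rightarrow> bool" where
  "walk V E xs \<longleftrightarrow> xs \<noteq> [] \<and> set xs \<subseteq> V \<and>
     (\<forall>i. Suc i < length xs \<longrightarrow> E (xs ! i) (xs ! Suc i))"

definition connected_graph :: "'a set \<Rightarrow> ('a \<Rightarrow> 'a \<Rightarrow> bool) \<Rightarrow> bool" where
  "connected_graph V E \<longleftrightarrow> graph V E \<and> V \<noteq> {} \<and>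
     (\<forall>u\<in>V. \<forall>v\<in>V. \<exists>xs. walk V E xs \<and> hd xs = u \<and> last xs = v)"

definition dist :: "'a set \<Rightarrow> ('a \<Rightarrow> 'a \<Rightarrow> bool) \<Rightarrow> 'a \<Rightarrow> 'a \<Rightarrow> nat" where
  "dist V E u v = (LEAST n. \<exists>xs. walk V E xs \<and> hd xs = u \<and> last xs = v \<and> length xs = Suc n)"

definition interval :: "'a set \<Rightarrow> ('a \<Rightarrow> 'a \<Rightarrow> bool) \<Rightarrow> 'a \<Rightarrow> 'a \<Rightarrow> 'a set" where
  "interval V E u v = {x \<in> V. dist V E u x + dist V E x v = dist V E u v}"

definition locally_finite :: "'a set \<Rightarrow> ('a \<Rightarrow> 'a \<Rightarrow> bool) \<Rightarrow> bool" where
  "locally_finite V E \<longleftrightarrow> (\<forall>v\<in>V. finite {w. E v w})"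

definition induced_square :: "('a \<Rightarrow> 'a \<Rightarrow> bool) \<Rightarrow> 'a \<Rightarrow> 'a \<Rightarrow> 'a \<Rightarrow> 'a \<Rightarrow> bool" where
  "induced_square E a b c d \<longleftrightarrow> distinct [a, b, c, d] \<and>
     E a b \<and> E b c \<and> E c d \<and> E d a \<and> \<not> E a c \<and> \<not> E b d"

definition thick :: "'a set \<Rightarrow> ('a \<Rightarrow> 'a \<Rightarrow> bool) \<Rightarrow> bool" where
  "thick V E \<longleftrightarrow> (\<forall>u\<in>V. \<forall>v\<in>V. dist V E u v = 2 \<longrightarrow>
     (\<exists>a b c d. {a, b, c, d} \<subseteq> interval V E u v \<and> induced_square E a b c d))"

definition LTC :: "'a set \<Rightarrow> ('a \<Rightarrow> 'a \<Rightarrow> bool) \<Rightarrow> 'a \<Rightarrow> bool" where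
  "LTC V E u \<longleftrightarrow> (\<forall>v\<in>V. \<forall>w\<in>V. E v w \<and> dist V E u v = 2 \<and> dist V E u w = 2 \<longrightarrow>
     (\<exists>x\<in>V. E x u \<and> E x v \<and> E x w))"

definition LQC :: "'a set \<Rightarrow> ('a \<Rightarrow> 'a \<Rightarrow> bool) \<Rightarrow> 'a \<Rightarrow> bool" where
  "LQC V E u \<longleftrightarrow> (\<forall>v\<in>V. \<forall>w\<in>V. \<forall>z\<in>V. E z v \<and> E z w \<and>
     dist V E v w = 2 \<and> dist V E u v = 2 \<and> dist V E u w = 2 \<and> dist V E u z = 3 \<longrightarrow>
     (\<exists>x\<in>V. E x u \<and> E x v \<and> E x w))"

definition locally_weakly_modular :: "'a set \<Rightarrow> ('a \<Rightarrow> 'a \<Rightarrow> bool) \<Rightarrow> bool" where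
  "locally_weakly_modular V E \<longleftrightarrow> (\<forall>u\<in>V. LTC V E u \<and> LQC V E u)"

definition has_induced_K4_minus :: "'a set \<Rightarrow> ('a \<Rightarrow> 'a \<Rightarrow> bool) \<Rightarrow> bool" where
  "has_induced_K4_minus V E \<longleftrightarrow> (\<exists>a\<in>V. \<exists>b\<in>V. \<exists>c\<in>V. \<exists>d\<in>V. distinct [a, b, c, d] \<and>
     \<not> E a b \<and> E a c \<and> E a d \<and> E b c \<and> E b d \<and> E c d)"

definition has_isometric_K33_minus :: "'a set \<Rightarrow> ('a \<Rightarrow> 'a \<Rightarrow> bool) \<Rightarrow> bool" where
  "has_isometric_K33_minus V E \<longleftrightarrow> (\<exists>a1\<in>V. \<exists>a2\<in>V. \<exists>a3\<in>V. \<exists>b1\<in>V. \<exists>b2\<in>V. \<exists>b3\<in>V.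
     distinct [a1, a2, a3, b1, b2, b3] \<and>
     E a1 b2 \<and> E a1 b3 \<and> E a2 b1 \<and> E a2 b2 \<and> E a2 b3 \<and> E a3 b1 \<and> E a3 b2 \<and> E a3 b3 \<and>
     dist V E a1 b1 = 3 \<and>
     dist V E a1 a2 = 2 \<and> dist V E a1 a3 = 2 \<and> dist V E a2 a3 = 2 \<and>
     dist V E b1 b2 = 2 \<and> dist V E b1 b3 = 2 \<and> dist V E b2 b3 = 2)"

definition locally_dual_polar :: "'a set \<Rightarrow> ('a \<Rightarrow> 'a \<Rightarrow> bool) \<Rightarrow> bool" where
  "locally_dual_polar V E \<longleftrightarrow> connected_graph V E \<and> thick V E \<and> locally_weakly_modular V E \<and>
     \<not> has_induced_K4_minus V E \<and> \<not> has_isometric_K33_minus V E"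

definition gated :: "'a set \<Rightarrow> ('a \<Rightarrow> 'a \<Rightarrow> bool) \<Rightarrow> 'a set \<Rightarrow> bool" where
  "gated V E S \<longleftrightarrow> S \<subseteq> V \<and> (\<forall>x\<in>V. \<exists>x'\<in>S. \<forall>y\<in>S. x' \<in> interval V E x y)"

text \<open>Smallest gated set containing A (gated sets are closed under intersection).\<close>
definition gated_hull :: "'a set \<Rightarrow> ('a \<Rightarrow> 'a \<Rightarrow> bool) \<Rightarrow> 'a set \<Rightarrow> 'a set" where
  "gated_hull V E A = \<Inter> {S. gated V E S \<and> A \<subseteq> S}"

definition clique :: "'a set \<Rightarrow> ('a \<Rightarrow> 'a \<Rightarrow> bool) \<Rightarrow> 'a set \<Rightarrow> bool" where
  "clique V E K \<longleftrightarrow> K \<subseteq> V \<and> (\<forall>x\<in>K. \<forall>y\<in>K. x \<noteq> y \<longrightarrow> E x y)"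

definition maximal_clique :: "'a set \<Rightarrow> ('a \<Rightarrow> 'a \<Rightarrow> bool) \<Rightarrow> 'a set \<Rightarrow> bool" where
  "maximal_clique V E K \<longleftrightarrow> clique V E K \<and> (\<forall>K'. clique V E K' \<and> K \<subseteq> K' \<longrightarrow> K' = K)"

definition dual_polar :: "'a set \<Rightarrow> ('a \<Rightarrow> 'a \<Rightarrow> bool) \<Rightarrow> bool" where
  "dual_polar V E \<longleftrightarrow> connected_graph V E \<and>
     \<comment> \<open>(A1)\<close>
     (\<forall>K. maximal_clique V E K \<longrightarrow> gated V E K) \<and>
     \<comment> \<open>(A3 and A4)\<close>
     (\<forall>u\<in>V. \<forall>v\<in>V. dist V E u v = 2 \<longrightarrow>
        (let H = gated_hull V E {u, v} in
          (\<forall>x\<in>H. \<forall>y\<in>H. dist V E x y \<le> 2) \<and> (\<exists>x\<in>H. \<exists>y\<in>H. dist V E x y = 2))) \<and>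
     \<comment> \<open>(A5)\<close>
     (\<forall>u\<in>V. \<forall>v\<in>V. \<forall>x\<in>V. u \<noteq> v \<and> \<not> E u v \<and> E u x \<and> x \<in> interval V E u v \<longrightarrow>
        (\<exists>y\<in>V. E v y \<and> y \<in> interval V E u v \<and>
           dist V E u v = dist V E x y \<and> dist V E x y = dist V E u y + 1 \<and>
           dist V E u y + 1 = dist V E x v + 1))"

text \<open>Elementary homotopies of walks across the 2-cells of the triangle-square complex:
  removing a backtrack x y x, replacing a side x y z of a triangle by x z, and
  replacing two consecutive sides x y z of an induced square x y z w by x w z.\<close>
definition hstep :: "('a \<Rightarrow> 'a \<Rightarrow> bool) \<Rightarrow> 'a list \<Rightarrow> 'a list \<Rightarrow> bool" where
  "hstep E p q \<longleftrightarrow>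
     (\<exists>a b x y. p = a @ [x, y, x] @ b \<and> q = a @ [x] @ b) \<or>
     (\<exists>a b x y z. E x y \<and> E y z \<and> E x z \<and> p = a @ [x, y, z] @ b \<and> q = a @ [x, z] @ b) \<or>
     (\<exists>a b x y z w. induced_square E x y z w \<and> p = a @ [x, y, z] @ b \<and> q = a @ [x, w, z] @ b)"

definition homotopic :: "'a set \<Rightarrow> ('a \<Rightarrow> 'a \<Rightarrow> bool) \<Rightarrow> 'a list \<Rightarrow> 'a list \<Rightarrow> bool" where
  "homotopic V E = (\<lambda>p q. walk V E p \<and> walk V E q \<and> (hstep E p q \<or> hstep E q p))\<^sup>*\<^sup>*"

text \<open>Vertices of the universal cover (based at b): homotopy classes of walks starting at b.\<close>
definition cover_V :: "'a set \<Rightarrow> ('a \<Rightarrow> 'a \<Rightarrow> bool) \<Rightarrow> 'a \<Rightarrow> 'a list set set" where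
  "cover_V V E b = {{q. homotopic V E p q} | p. walk V E p \<and> hd p = b}"

definition cover_E :: "'a set \<Rightarrow> ('a \<Rightarrow> 'a \<Rightarrow> bool) \<Rightarrow> 'a \<Rightarrow> 'a list set \<Rightarrow> 'a list set \<Rightarrow> bool" where
  "cover_E V E b C D \<longleftrightarrow> C \<in> cover_V V E b \<and> D \<in> cover_V V E b \<and>
     ((\<exists>p\<in>C. \<exists>v. E (last p) v \<and> p @ [v] \<in> D) \<or> (\<exists>p\<in>D. \<exists>v. E (last p) v \<and> p @ [v] \<in> C))"

end

theory Submission
  imports Defs
begin

text \<open>
  The core is a local-to-global principle: in a connected, locally weakly modular graph all of whose
  closed walks are null-homotopic, the triangle and quadrangle conditions hold at all distances.
  Fix a base point and call a walk reduced if no sequence of moves \<open>x y z \<leadsto> x w z\<close> (with \<open>x\<close>, \<open>z\<close> at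
  distance 2) makes it shortcuttable. The local conditions alone imply that if a reduced class
  can be entered through two different last edges, then these have a common origin two steps earlier;
  hence reduced walks modulo moves form a graph that covers the given one, and triangles and induced
  squares lift to it. Homotopic walks
  therefore have the same normal form, so in the simply connected case the reduced walks are the
  geodesics, and the common origin is exactly the vertex demanded by the triangle and quadrangle
  conditions.

  The universal cover is simply connected and inherits the local hypotheses, so both conditions hold
  in it. Lines are then maximal cliques, and two vertices at distance 2 span a quad, consisting of the
  vertices that see the base vertex along the same lines. Quads are closed under common neighbours and
  have diameter 2, hence are gated, and opposite neighbours (A5) are found by projecting to a quad.
  Finally, by (A5) the number of neighbours of \<open>u\<close> on geodesics to \<open>v\<close> strictly increases along
  geodesics, so degrees bound distances.
\<close>

section \<open>Reduced walks in a locally weakly modular graph\<close>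

text \<open>Until simple connectedness has been used, the length of a reduced walk is not known to
  be a distance, so no metric argument is available for reduced walks. Hence \<open>far2\<close> and
  \<open>beyond2\<close>, which express distance 2 and distance at least 3 through adjacency alone;
  they also make the local conditions easy to transport along a covering. No quotient is formed:
  swap classes are handled through representatives, and every statement about them holds up to
  \<open>eqv\<close>. Swaps suffice because each local condition has a counterpart for walks. The
  quadrangle condition makes two ways of entering a class meet two steps earlier; the triangle
  condition does the same for the ends of an edge whose two lifts have equal length. Thickness and
  the two forbidden subgraphs enter with the quads. Without induced \<open>K_4^-\<close>, adjacency
  among the neighbours of a vertex is transitive, so lines are well defined; thickness and the
  absence of \<open>K_{3,3}^-\<close> make two lines through a vertex determine a quad.\<close>

definition far2 :: "('a \<Rightarrow> 'a \<Rightarrow> bool) \<Rightarrow> 'a \<Rightarrow> 'a \<Rightarrow> bool" where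
  "far2 E x y \<longleftrightarrow> x \<noteq> y \<and> \<not> E x y \<and> (\<exists>c. E x c \<and> E c y)"

definition beyond2 :: "('a \<Rightarrow> 'a \<Rightarrow> bool) \<Rightarrow> 'a \<Rightarrow> 'a \<Rightarrow> bool" where
  "beyond2 E x y \<longleftrightarrow> x \<noteq> y \<and> \<not> E x y \<and> (\<forall>c. \<not> (E x c \<and> E c y))"

lemma hstep_hd: "hstep E xs ys \<Longrightarrow> hd xs = hd ys"
  unfolding hstep_def by (auto simp: hd_append split: if_splits)

text \<open>The quadrangle condition makes no demand on the distance of \<open>v\<close> and
  \<open>w\<close>: if they coincide, \<open>far2 E u v\<close> provides the common neighbour, and
  if they are adjacent, the triangle condition does. This spares the distinction at each
  use.\<close>

locale lwm =
  fixes E :: "'a \<Rightarrow> 'a \<Rightarrow> bool" and b :: 'a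
  assumes sym: "E x y \<Longrightarrow> E y x"
    and irrefl: "\<not> E x x"
    and triangle: "\<lbrakk>E v w; far2 E u v; far2 E u w\<rbrakk> \<Longrightarrow> \<exists>x. E x u \<and> E x v \<and> E x w"
    and quadrangle: "\<lbrakk>E z v; E z w; far2 E u v; far2 E u w; beyond2 E u z\<rbrakk>
          \<Longrightarrow> \<exists>x. E x u \<and> E x v \<and> E x w"
begin

text \<open>Walks from \<open>b\<close> are stored in reverse: the head of the list is the current vertex.\<close>

inductive rwalk :: "'a list \<Rightarrow> bool" where
  base: "rwalk [b]"
| step: "\<lbrakk>rwalk p; E x (hd p)\<rbrakk> \<Longrightarrow> rwalk (x # p)"

inductive swap :: "'a list \<Rightarrow> 'a list \<Rightarrow> bool" where
  top: "\<lbrakk>E z y; E y x; E z w; E w x; z \<noteq> x; \<not> E z x\<rbrakk> \<Longrightarrow> swap (z # y # x # r) (z # w # x # r)"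
| cons: "swap p q \<Longrightarrow> swap (z # p) (z # q)"

abbreviation eqv :: "'a list \<Rightarrow> 'a list \<Rightarrow> bool" (infix "\<approx>" 50) where
  "p \<approx> q \<equiv> swap\<^sup>*\<^sup>* p q"

fun stiff :: "'a list \<Rightarrow> bool" where
  "stiff (x # y # z # r) \<longleftrightarrow> x \<noteq> z \<and> \<not> E x z \<and> stiff (y # z # r)"
| "stiff p \<longleftrightarrow> True"

text \<open>All representatives must be stiff, because a swap can create a shortcut that the
  original walk did not show. Reducedness thus belongs to the class.\<close>

definition red :: "'a list \<Rightarrow> bool" where
  "red p \<longleftrightarrow> rwalk p \<and> (\<forall>q. p \<approx> q \<longrightarrow> stiff q)"

lemma rwalk_not_Nil [simp]: "\<not> rwalk []"
  by (auto elim: rwalk.cases)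

lemma rwalk_single [simp]: "rwalk [x] \<longleftrightarrow> x = b"
  by (auto elim: rwalk.cases intro: rwalk.base)

lemma rwalk_Cons [simp]: "rwalk (x # y # p) \<longleftrightarrow> E x y \<and> rwalk (y # p)"
  by (auto elim: rwalk.cases intro: rwalk.step)

lemma swap_hd: "swap p q \<Longrightarrow> hd p = hd q"
  by (induction rule: swap.induct) auto

lemma swap_length: "swap p q \<Longrightarrow> length p = length q"
  by (induction rule: swap.induct) auto

lemma swap_sym: "swap p q \<Longrightarrow> swap q p"
  by (induction rule: swap.induct) (auto intro: swap.intros)

lemma swap_rwalk: "swap p q \<Longrightarrow> rwalk p \<Longrightarrow> rwalk q"
proof (induction rule: swap.induct)
  case (cons p q z)
  then show ?case
    using swap_hd[OF cons(1)] swap_length[OF cons(1)]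
    by (cases p; cases q) auto
qed auto

lemma eqv_sym: "p \<approx> q \<Longrightarrow> q \<approx> p"
  by (induction rule: rtranclp_induct) (auto intro: swap_sym converse_rtranclp_into_rtranclp)

lemma eqv_trans: "p \<approx> q \<Longrightarrow> q \<approx> r \<Longrightarrow> p \<approx> r"
  by (rule rtranclp_trans)

lemma eqv_hd: "p \<approx> q \<Longrightarrow> hd p = hd q"
  by (induction rule: rtranclp_induct) (auto dest: swap_hd)

lemma eqv_length: "p \<approx> q \<Longrightarrow> length p = length q"
  by (induction rule: rtranclp_induct) (auto dest: swap_length)

lemma eqv_rwalk: "p \<approx> q \<Longrightarrow> rwalk p \<Longrightarrow> rwalk q"
  by (induction rule: rtranclp_induct) (auto dest: swap_rwalk)

lemma eqv_Cons: "p \<approx> q \<Longrightarrow> z # p \<approx> z # q"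
  by (induction rule: rtranclp_induct) (auto intro: swap.cons rtranclp.rtrancl_into_rtrancl)

lemma eqv_top: "\<lbrakk>E z y; E y x; E z w; E w x; z \<noteq> x; \<not> E z x\<rbrakk> \<Longrightarrow> z # y # x # r \<approx> z # w # x # r"
  by (auto intro: swap.top)

lemma eqv_single: "[x] \<approx> q \<Longrightarrow> q = [x]"
proof -
  assume "[x] \<approx> q"
  then have "length q = 1" "hd q = x"
    by (auto dest: eqv_length eqv_hd)
  then show ?thesis by (cases q) auto
qed

lemma red_rwalk: "red p \<Longrightarrow> rwalk p"
  by (simp add: red_def)

lemma red_not_Nil: "red p \<Longrightarrow> p \<noteq> []"
  by (auto dest: red_rwalk)

lemma red_Nil [simp]: "\<not> red []"
  by (auto dest: red_rwalk)

lemma red_stiff: "red p \<Longrightarrow> stiff p"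
  by (simp add: red_def)

lemma red_eqv: "red p \<Longrightarrow> p \<approx> q \<Longrightarrow> red q"
  by (meson red_def eqv_rwalk eqv_trans)

lemma stiff_tl: "stiff (x # p) \<Longrightarrow> stiff p"
  by (cases p rule: stiff.cases) auto

lemma red_tl: "red (x # p) \<Longrightarrow> p \<noteq> [] \<Longrightarrow> red p"
  unfolding red_def by (cases p) (auto intro: stiff_tl dest: eqv_Cons)

lemma red_base: "red [b]"
  by (auto simp: red_def dest: eqv_single)

lemma red_far2:
  assumes "red (z # y # x # r)"
  shows "far2 E z x" "far2 E x z" "E z y" "E y x"
proof -
  show e: "E z y" "E y x"
    using red_rwalk[OF assms] by auto
  show "far2 E z x"
    using red_stiff[OF assms] e unfolding far2_def by auto
  then show "far2 E x z"
    unfolding far2_def using sym by blast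
qed

lemma red_top:
  assumes "red (z # y # x # r)" "E z w" "E w x"
  shows "z # y # x # r \<approx> z # w # x # r"
  using red_far2[OF assms(1)] assms eqv_top[of z y x w r] unfolding far2_def by auto

lemma far2_sym: "far2 E x y \<Longrightarrow> far2 E y x"
  unfolding far2_def using sym by blast

text \<open>A neighbour of both \<open>u\<close> and \<open>v\<close> that equals or is adjacent to
  \<open>z\<close> could be swapped in for \<open>x\<close> and would destroy stiffness. If
  \<open>u\<close> and \<open>z\<close> had distance 2, the triangle condition at \<open>u\<close>
  over the edge \<open>v z\<close> would supply such a neighbour.\<close>

lemma red_beyond2:
  assumes red: "red (z # v # x # u # t)"
  shows "beyond2 E u z"
proof -
  have r: "red (v # x # u # t)" using red_tl[OF red] by simp
  note f = red_far2[OF r] red_far2[OF red]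
  have ne: "u \<noteq> z" using f sym by (auto simp: far2_def)
  have nE: "\<not> E u z"
  proof
    assume "E u z"
    then have "v # x # u # t \<approx> v # z # u # t"
      using red_top[OF r, of z] f sym by blast
    then have "red (z # v # z # u # t)"
      using red_eqv[OF red eqv_Cons] by blast
    then show False by (auto dest: red_stiff)
  qed
  have "\<not> (E u c \<and> E c z)" for c
  proof
    assume c: "E u c \<and> E c z"
    then have "far2 E u z" using ne nE by (auto simp: far2_def)
    then obtain c where c: "E c u" "E c v" "E c z"
      using triangle[of v z u] f sym by blast
    then have "v # x # u # t \<approx> v # c # u # t"
      using red_top[OF r, of c] sym by blast
    then have "red (z # v # c # u # t)"
      using red_eqv[OF red eqv_Cons] by blast
    then show False using c sym by (auto dest: red_stiff)
  qed
  then show ?thesis using ne nE by (auto simp: beyond2_def)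
qed

section \<open>Last edges of a reduced class and extension of reduced walks\<close>

lemma swap_Cons_cases:
  assumes "swap (z # p) q"
  obtains p' where "q = z # p'" "swap p p'"
  | y x w r where "p = y # x # r" "q = z # w # x # r" "E z y" "E y x" "E z w" "E w x" "z \<noteq> x" "\<not> E z x"
  using assms by (cases rule: swap.cases) auto

text \<open>The chain of swaps is followed with \<open>p\<close> held fixed, keeping a common parent
  \<open>t\<close> of \<open>p\<close> and the current walk. Only a swap of the vertex just below
  \<open>z\<close> can destroy \<open>t\<close>; induction on the length, one edge further down,
  repairs it.\<close>

lemma red_parents:
  assumes "red (z # p)" "p \<noteq> []" "z # p \<approx> z # q"
  shows "p = [b] \<and> q = [b] \<or> (\<exists>t. p \<approx> hd p # t \<and> q \<approx> hd q # t \<and> t \<noteq> [])"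
  using assms
proof (induction "length p" arbitrary: z p q rule: less_induct)
  case less
  note pn = less.prems(2)
  show ?case
  proof (cases "tl p")
    case Nil
    then obtain x where p: "p = [x]" using pn by (cases p) auto
    then have "x = b" using red_rwalk[OF less.prems(1)] by simp
    moreover have "q = [x]"
    proof -
      have "q = [x]" if "[z, x] \<approx> z # q" for q
      proof -
        have "r = [z, x]" if "[z, x] \<approx> r" for r
          using that by (induction rule: rtranclp_induct) (auto elim!: swap.cases)
        then show ?thesis using that by blast
      qed
      then show ?thesis using less.prems(3) p by simp
    qed
    ultimately show ?thesis using p by simp
  next
    case (Cons x0 r0)
    then obtain v where p: "p = v # x0 # r0" using pn by (cases p) auto
    have "\<exists>q t. s = z # q \<and> p \<approx> v # t \<and> q \<approx> hd q # t \<and> t \<noteq> []" if "z # p \<approx> s" for s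
      using that
    proof (induction rule: rtranclp_induct)
      case base
      show ?case using p by auto
    next
      case (step s s')
      then obtain q r where s: "s = z # q" and r: "p \<approx> v # r" "q \<approx> hd q # r" "r \<noteq> []" by blast
      from step.hyps(2) show ?case unfolding s
      proof (cases rule: swap_Cons_cases)
        case (1 q')
        then have "q' \<approx> hd q' # r"
          using r swap_hd[OF 1(2)] swap_sym[OF 1(2)] by (metis converse_rtranclp_into_rtranclp)
        then show ?thesis using 1 r by auto
      next
        case (2 w x w' r')
        have red_s: "red s" "red (z # w' # x # r')"
          using red_eqv[OF less.prems(1)] step.hyps s 2 by (blast intro: rtranclp.rtrancl_into_rtrancl)+
        then have red_q: "red q" using s 2 by (auto intro: red_tl)
        have wr: "w # x # r' \<approx> w # r" using r 2 by simp
        have red_wr: "red (w # r)" using red_eqv[OF red_q] wr 2 by simp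
        have "length r < length p" using eqv_length[OF r(1)] by simp
        \<comment> \<open>Both \<open>r\<close> and \<open>x # r'\<close> extend by \<open>w\<close>
          to the same shorter class, so they meet at some \<open>u\<close>, three steps below
          \<open>z\<close>.\<close>
        from less.hyps[OF this red_wr r(3) eqv_sym[OF wr]]
        have "\<exists>t. p \<approx> v # t \<and> w' # x # r' \<approx> w' # t \<and> t \<noteq> []"
        proof
          assume "r = [b] \<and> x # r' = [b]"
          then show ?thesis using r by auto
        next
          assume "\<exists>t. r \<approx> hd r # t \<and> x # r' \<approx> hd (x # r') # t \<and> t \<noteq> []"
          then obtain a u t where t: "r \<approx> a # u # t" "x # r' \<approx> x # u # t"
            by (metis list.exhaust list.sel(1))
          have e: "p \<approx> v # a # u # t"
            using eqv_trans[OF r(1) eqv_Cons[OF t(1)]] .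
          have e': "w' # x # r' \<approx> w' # x # u # t"
            using eqv_Cons[OF t(2)] .
          have r1: "red (z # v # a # u # t)"
            using red_eqv[OF less.prems(1) eqv_Cons[OF e]] .
          have r2: "red (z # w' # x # u # t)"
            using red_eqv[OF red_s(2) eqv_Cons[OF e']] .
          have r3: "red (v # a # u # t)" "red (w' # x # u # t)"
            using r1 r2 red_tl by blast+
          \<comment> \<open>\<open>u\<close> is beyond distance 2 from \<open>z\<close>, hence the
            quadrangle condition applies to \<open>v\<close> and \<open>w'\<close>;
            \<open>y # u # t\<close> is the new common parent.\<close>
          obtain y where y: "E y u" "E y v" "E y w'"
            using quadrangle[of z v w' u] red_far2[OF r3(1)] red_far2[OF r3(2)]
              red_far2[OF r1] red_far2[OF r2] red_beyond2[OF r1] by blast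
          have "v # a # u # t \<approx> v # y # u # t" "w' # x # u # t \<approx> w' # y # u # t"
            using red_top[OF r3(1)] red_top[OF r3(2)] y sym by blast+
          then have "p \<approx> v # y # u # t" "w' # x # r' \<approx> w' # y # u # t"
            using e e' eqv_trans by blast+
          then show ?thesis by blast
        qed
        then show ?thesis using 2 by auto
      qed
    qed
    then show ?thesis using less.prems(3) p by fastforce
  qed
qed

lemma two_parents:
  assumes "red p" "p \<approx> z # q" "p \<approx> z # q'" "q \<noteq> []"
  obtains "q = [b]" "q' = [b]"
  | u t where "q \<approx> hd q # u # t" "q' \<approx> hd q' # u # t"
proof -
  have "red (z # q)" "z # q \<approx> z # q'"
    using assms red_eqv eqv_sym eqv_trans by blast+
  from red_parents[OF this(1) assms(4) this(2)] show ?thesis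
    using that by (metis list.exhaust)
qed

text \<open>The hypothesis that no last edge of \<open>p\<close> comes from \<open>y\<close> or from
  a neighbour of \<open>y\<close> survives swaps inside \<open>p\<close>. A swap at the top replaces
  the last vertex by \<open>x'\<close>; reducedness of the new walk then comes from the induction
  hypothesis, and the hypothesis on \<open>y\<close> from common ancestors.\<close>

lemma red_extend:
  assumes "red p" "E y (hd p)"
    and "\<And>r. \<lbrakk>p \<approx> hd p # r; r \<noteq> []\<rbrakk> \<Longrightarrow> hd r \<noteq> y \<and> \<not> E (hd r) y"
  shows "red (y # p)"
  using assms
proof (induction "length p" arbitrary: y p rule: less_induct)
  case less
  have inv: "\<exists>q. s = y # q \<and> red q \<and> E y (hd q) \<and>
      (\<forall>r. q \<approx> hd q # r \<longrightarrow> r \<noteq> [] \<longrightarrow> hd r \<noteq> y \<and> \<not> E (hd r) y)" if "y # p \<approx> s" for s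
    using that
  proof (induction rule: rtranclp_induct)
    case base
    show ?case using less.prems by blast
  next
    case (step s s')
    then obtain q where s: "s = y # q" and q: "red q" "E y (hd q)"
      and cond: "\<And>r. \<lbrakk>q \<approx> hd q # r; r \<noteq> []\<rbrakk> \<Longrightarrow> hd r \<noteq> y \<and> \<not> E (hd r) y" by blast
    from step.hyps(2) show ?case unfolding s
    proof (cases rule: swap_Cons_cases)
      case (1 q')
      have "q \<approx> q'" "hd q' = hd q" using 1 swap_hd by auto
      then show ?thesis using 1 q cond red_eqv eqv_trans by metis
    next
      case (2 x a x' r)
      have red_ar: "red (a # r)" using q 2 red_tl by blast
      \<comment> \<open>The argument of \<open>red_beyond2\<close> for the walk that continues to
        \<open>y\<close>, with \<open>cond\<close> in place of the reducedness that is still to be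
        shown.\<close>
      have key: "beyond2 E u y" if "a # r \<approx> a # u # t" for u t
      proof -
        have e: "q \<approx> x # a # u # t" using eqv_Cons[OF that] 2 by simp
        note rx = red_eqv[OF q(1) e]
        have no: "c \<noteq> y \<and> \<not> E c y" if "E c u" "E x c" for c
        proof -
          have "q \<approx> x # c # u # t"
            using e red_top[OF rx, of c] that eqv_trans by blast
          then show ?thesis using cond[of "c # u # t"] 2 by simp
        qed
        have "E x y" using q 2 sym by simp
        have ne: "u \<noteq> y" using red_far2[OF rx] \<open>E x y\<close> by (auto simp: far2_def)
        have nE: "\<not> E u y" using no[of y] \<open>E x y\<close> sym by blast
        have "\<not> (E u c \<and> E c y)" for c
        proof
          assume "E u c \<and> E c y"
          then have "far2 E u y" using ne nE by (auto simp: far2_def)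
          then obtain c where "E c u" "E c x" "E c y"
            using triangle[of x y u] red_far2[OF rx] \<open>E x y\<close> by blast
          then show False using no[of c] sym by blast
        qed
        then show ?thesis using ne nE by (auto simp: beyond2_def)
      qed
      have len: "length (a # r) < length p"
        using eqv_length[OF step.hyps(1)] s 2 by simp
      have red': "red (x' # a # r)"
      proof (rule less.hyps[OF len red_ar])
        show "E x' (hd (a # r))" using 2 by simp
        fix r' assume r': "a # r \<approx> hd (a # r) # r'" "r' \<noteq> []"
        then obtain u t where "r' = u # t" by (cases r') auto
        then show "hd r' \<noteq> x' \<and> \<not> E (hd r') x'"
          using key[of u t] r' 2 sym unfolding beyond2_def by auto
      qed
      have "hd r' \<noteq> y \<and> \<not> E (hd r') y" if r': "x' # a # r \<approx> x' # r'" "r' \<noteq> []" for r'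
      proof (rule two_parents[OF red' rtranclp.rtrancl_refl r'(1)])
        assume "a # r = [b]" "r' = [b]"
        then show ?thesis using 2 sym by auto
      next
        fix u t assume e: "a # r \<approx> hd (a # r) # u # t" "r' \<approx> hd r' # u # t"
        have "red (x' # hd r' # u # t)"
          using red_eqv[OF red_eqv[OF red' r'(1)] eqv_Cons[OF e(2)]] .
        then have "E (hd r') u" using red_rwalk by fastforce
        then show ?thesis using key[of u t] e sym unfolding beyond2_def by auto
      qed simp
      then show ?thesis using 2 red' by auto
    qed
  qed
  have "stiff s" if st: "y # p \<approx> s" for s
  proof -
    obtain q where s: "s = y # q" and q: "red q" "E y (hd q)"
      and cond: "\<And>r. \<lbrakk>q \<approx> hd q # r; r \<noteq> []\<rbrakk> \<Longrightarrow> hd r \<noteq> y \<and> \<not> E (hd r) y"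
      using inv[OF st] by blast
    show ?thesis
    proof (cases q rule: stiff.cases)
      case (1 x a z r)
      then show ?thesis using red_stiff[OF q(1)] cond[of "a # z # r"] sym s by auto
    next
      case ("2_3" x a)
      then show ?thesis using cond[of "[a]"] sym s by auto
    qed (auto simp: s)
  qed
  moreover have "rwalk (y # p)"
    using less.prems red_rwalk by (cases p) auto
  ultimately show ?case by (simp add: red_def)
qed

section \<open>The covering graph formed by reduced classes\<close>

text \<open>Lifts of an edge: the reduced walk grows, shrinks, or keeps its length, in which case
  both ends extend a common walk. \<open>adj_exists\<close> and \<open>adj_unique\<close> say that
  every edge lifts uniquely up to \<open>eqv\<close>.\<close>

definition adj :: "'a list \<Rightarrow> 'a list \<Rightarrow> bool" where
  "adj p q \<longleftrightarrow> red p \<and> red q \<and> E (hd p) (hd q) \<and>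
     (q \<approx> hd q # p \<or> p \<approx> hd p # q \<or> (\<exists>r. r \<noteq> [] \<and> p \<approx> hd p # r \<and> q \<approx> hd q # r))"

lemma adj_sym: "adj p q \<Longrightarrow> adj q p"
  using sym by (auto simp: adj_def)

lemma adj_cases [consumes 1, case_names up down level]:
  assumes "adj p q"
  obtains "q \<approx> hd q # p" | "p \<approx> hd p # q"
  | r where "r \<noteq> []" "p \<approx> hd p # r" "q \<approx> hd q # r"
  using assms unfolding adj_def by blast

lemma adjD: "adj p q \<Longrightarrow> red p" "adj p q \<Longrightarrow> red q" "adj p q \<Longrightarrow> E (hd p) (hd q)"
  by (auto simp: adj_def)

lemma red_Cons_E: "red q \<Longrightarrow> q \<approx> y # p \<Longrightarrow> p \<noteq> [] \<Longrightarrow> E (hd p) y \<and> red p"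
proof -
  assume "red q" "q \<approx> y # p" and p: "p \<noteq> []"
  then have r: "red (y # p)" using red_eqv by blast
  then have "red p" using red_tl p by blast
  moreover have "E (hd p) y" using red_rwalk[OF r] p sym by (cases p) auto
  ultimately show ?thesis by blast
qed

lemma adj_up: "red q \<Longrightarrow> q \<approx> y # p \<Longrightarrow> p \<noteq> [] \<Longrightarrow> adj p q"
  using red_Cons_E[of q y p] eqv_hd[of q "y # p"] by (auto simp: adj_def)

lemma adj_down: "red q \<Longrightarrow> q \<approx> y # p \<Longrightarrow> p \<noteq> [] \<Longrightarrow> adj q p"
  by (rule adj_sym[OF adj_up])

lemma adj_level: "\<lbrakk>red p; red q; p \<approx> x # r; q \<approx> y # r; r \<noteq> []; E x y\<rbrakk> \<Longrightarrow> adj p q"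
  using eqv_hd[of p "x # r"] eqv_hd[of q "y # r"] by (auto simp: adj_def)

lemma adj_eqv: 
  assumes "adj p q" "p \<approx> p'" "q \<approx> q'" shows "adj p' q'"
proof -
  have h: "hd p' = hd p" "hd q' = hd q" using assms eqv_hd by auto
  have r: "red p" "red q" "red p'" "red q'" "E (hd p) (hd q)" using adjD[OF assms(1)] assms red_eqv by auto
  have bk: "p' \<approx> p" "q' \<approx> q" using assms eqv_sym by auto
  from assms(1) show ?thesis
  proof (cases rule: adj_cases)
    case up
    then have "q' \<approx> hd q # p'" using bk assms eqv_trans eqv_Cons by meson
    from adj_up[OF r(4) this] show ?thesis using r(3) red_not_Nil by blast
  next
    case down
    then have "p' \<approx> hd p # q'" using bk assms eqv_trans eqv_Cons by meson
    from adj_down[OF r(3) this] show ?thesis using r(4) red_not_Nil by blast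
  next
    case (level s)
    then have "p' \<approx> hd p # s" "q' \<approx> hd q # s" using bk eqv_trans by meson+
    from adj_level[OF r(3,4) this level(1) r(5)] show ?thesis .
  qed
qed

text \<open>The shortest option is taken: shrink if some representative arrives from
  \<open>y\<close>, else stay level if some representative arrives from a neighbour of
  \<open>y\<close>, else append \<open>y\<close>. Failure of the earlier options is what
  \<open>red_extend\<close> requires.\<close>

lemma adj_exists:
  assumes "red p" "E (hd p) y"
  shows "\<exists>q. adj p q \<and> hd q = y"
proof (cases "\<exists>r. p \<approx> hd p # r \<and> r \<noteq> [] \<and> hd r = y")
  case True
  then obtain r where r: "p \<approx> hd p # r" "r \<noteq> []" "hd r = y" by blast
  show ?thesis using adj_down[OF assms(1) r(1,2)] r(3) by blast
next
  case no_down: False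
  show ?thesis
  proof (cases "\<exists>r. p \<approx> hd p # r \<and> r \<noteq> [] \<and> E (hd r) y")
    case True
    then obtain r where r: "p \<approx> hd p # r" "r \<noteq> []" "E (hd r) y" by blast
    have red_r: "red r" using r assms red_Cons_E by blast
    have "red (y # r)"
    proof (rule red_extend[OF red_r])
      show "E y (hd r)" using r sym by blast
      fix s assume s: "r \<approx> hd r # s" "s \<noteq> []"
      then obtain u t where u: "s = u # t" by (cases s) auto
      have e: "p \<approx> hd p # hd r # u # t" using eqv_trans[OF r(1) eqv_Cons[OF s(1)]] u by simp
      note rp = red_eqv[OF assms(1) e]
      have "u \<noteq> y" using red_far2[OF rp] assms by (auto simp: far2_def)
      \<comment> \<open>Otherwise \<open>y\<close> could be swapped in just below
        \<open>hd p\<close>, and \<open>p\<close> would arrive from \<open>y\<close> after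
        all.\<close>
      moreover have "\<not> E u y"
      proof
        assume "E u y"
        then have "p \<approx> hd p # y # u # t" using red_top[OF rp, of y] e assms sym eqv_trans by blast
        then show False using no_down by fastforce
      qed
      ultimately show "hd s \<noteq> y \<and> \<not> E (hd s) y" using u by simp
    qed
    from adj_level[OF assms(1) this r(1) rtranclp.rtrancl_refl r(2) assms(2)] have "adj p (y # r)" .
    then show ?thesis by auto
  next
    case False
    then have "red (y # p)" using no_down red_extend[of p y] assms sym by blast
    from adj_up[OF this rtranclp.rtrancl_refl] have "adj p (y # p)"
      using assms(1) red_not_Nil by blast
    then show ?thesis by auto
  qed
qed

lemma eqv_under: "p \<approx> x # q \<Longrightarrow> q \<approx> q' \<Longrightarrow> p \<approx> x # q'"
  using eqv_Cons eqv_trans by blast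

lemma eqv_far2:
  assumes "red p" "p \<approx> z # y # x # r"
  shows "far2 E z x" "far2 E x z" "E z y" "E y x" "E y z" "E x y" "z \<noteq> x" "\<not> E z x"
  using red_far2[OF red_eqv[OF assms]] sym by (auto simp: far2_def)

lemma eqv_retop: "\<lbrakk>red p; p \<approx> z # y # x # r; E z w; E w x\<rbrakk> \<Longrightarrow> p \<approx> z # w # x # r"
  using red_top red_eqv eqv_trans by blast

lemma eqv_common: "p \<approx> r \<Longrightarrow> q \<approx> r \<Longrightarrow> p \<approx> q"
  using eqv_sym eqv_trans by blast

text \<open>Steps of different kinds would contradict stiffness of some representative. Two steps
  down, or two level steps, are compared through the common ancestor given by
  \<open>two_parents\<close>, with a single swap in the level case.\<close>

lemma adj_unique:
  assumes "adj p q" "adj p q'" and y: "hd q = y" "hd q' = y"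
  shows "q \<approx> q'"
proof -
  note r = adjD(1)[OF assms(1)] adjD(2)[OF assms(1)] adjD(2)[OF assms(2)]
  have up_other: False if "adj p q'" "q \<approx> y # p" "red q" "\<not> q' \<approx> y # p" "hd q' = y" "red q'" for q q'
    using that(1)
  proof (cases rule: adj_cases)
    case up
    then show ?thesis using that by simp
  next
    case down
    then have "q \<approx> y # hd p # q'" using eqv_under that by blast
    then have "q \<approx> y # hd p # y # tl q'" using that by (cases q') auto
    from eqv_far2(7)[OF that(3) this] show ?thesis by simp
  next
    case (level s)
    then have "q \<approx> y # hd p # hd s # tl s" using eqv_under[OF that(2)] by simp
    from eqv_far2(8)[OF that(3) this] have "\<not> E y (hd s)" .
    moreover have "E y (hd s)"
      using red_Cons_E[OF that(6) level(3,1)] that(5) sym[of "hd s" y] by simp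
    ultimately show ?thesis by simp
  qed
  have down_level: False if "p \<approx> hd p # q" "p \<approx> hd p # s" "q' \<approx> y # s" "s \<noteq> []"
      "red q" "red q'" "hd q = y" "hd q' = y" for q q' s
  proof -
    have E: "E (hd s) y" using red_Cons_E[OF that(6) that(3)] that by simp
    show False
    proof (rule two_parents[OF r(1) that(1,2)])
      show "q \<noteq> []" using that(5) by auto
      assume "q = [b]" "s = [b]"
      then show False using E that irrefl by auto
    next
      fix u t assume t: "q \<approx> hd q # u # t" "s \<approx> hd s # u # t"
      have "E y u" using red_Cons_E[OF that(5) t(1)] that sym[of u y] by simp
      then show False using eqv_far2(8)[OF that(6) eqv_under[OF that(3) t(2)]] by simp
    qed
  qed
  from assms(1) show ?thesis
  proof (cases rule: adj_cases)
    case up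
    then have q: "q \<approx> y # p" using y by simp
    show ?thesis
      using up_other[OF assms(2) q r(2) _ y(2) r(3)] eqv_common q by blast
  next
    case down
    note q = this
    from assms(2) show ?thesis
    proof (cases rule: adj_cases)
      case up
      then have "q' \<approx> y # p" using y by simp
      then show ?thesis
        using up_other[OF assms(1) _ r(3) _ y(1) r(2)] eqv_common by blast
    next
      case down
      show ?thesis
      proof (rule two_parents[OF r(1) q down])
        show "q \<noteq> []" using r by auto
        fix u t assume "q \<approx> hd q # u # t" "q' \<approx> hd q' # u # t"
        then show ?thesis using y by (auto intro: eqv_common)
      qed auto
    next
      case (level s)
      from down_level[OF q level(2) _ level(1) r(2,3) y] level(3) y(2) show ?thesis by auto
    qed
  next
    case (level s)
    note q = this
    from assms(2) show ?thesis
    proof (cases rule: adj_cases)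
      case up
      then have "q' \<approx> y # p" using y by simp
      then show ?thesis
        using up_other[OF assms(1) _ r(3) _ y(1) r(2)] eqv_common by blast
    next
      case down
      from down_level[OF down q(2) _ q(1) r(3,2) y(2,1)] q(3) y(1) show ?thesis by auto
    next
      case (level s')
      show ?thesis
      proof (rule two_parents[OF r(1) q(2) level(2) q(1)])
        assume "s = [b]" "s' = [b]"
        then show ?thesis using q level y by (auto intro: eqv_common)
      next
        fix u t assume t: "s \<approx> hd s # u # t" "s' \<approx> hd s' # u # t"
        have e: "q \<approx> y # hd s # u # t" "q' \<approx> y # hd s' # u # t"
          using eqv_under[OF q(3) t(1)] eqv_under[OF level(3) t(2)] y by auto
        have "q \<approx> y # hd s' # u # t"
          by (rule eqv_retop[OF r(2) e(1) eqv_far2(3,4)[OF r(3) e(2)]])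
        then show ?thesis using e eqv_common by blast
      qed
    qed
  qed
qed

section \<open>Lifting triangles and squares\<close>

text \<open>Up and down cannot occur together. Two level steps need the triangle condition, taken at
  a common ancestor of their parents; the other combinations follow from a swap or from
  \<open>two_parents\<close>.\<close>

lemma adj_triangle:
  assumes "adj p q" "adj p q'" and E: "E (hd q) (hd q')"
  shows "adj q q'"
proof -
  note r = adjD(1)[OF assms(1)] adjD(2)[OF assms(1)] adjD(2)[OF assms(2)]
  have n: "p \<noteq> []" "q \<noteq> []" "q' \<noteq> []" using r by auto
  have up_down: False if "q \<approx> hd q # p" "p \<approx> hd p # q'" "E (hd q) (hd q')" "red q" "red q'" for q q'
  proof -
    have "q \<approx> hd q # hd p # hd q' # tl q'" using eqv_under that by (cases q') auto
    from eqv_far2(8)[OF that(4) this] that(3) show False by simp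
  qed
  have up_level: "adj q q'" if "q \<approx> hd q # p" "p \<approx> hd p # s" "q' \<approx> hd q' # s" "s \<noteq> []"
      "E (hd q) (hd q')" "red q" "red q'" for q q' s
  proof -
    have "q \<approx> hd q # hd p # hd s # tl s" using eqv_under that by simp
    from eqv_retop[OF that(6) this that(5)] have "q \<approx> hd q # hd q' # hd s # tl s"
      using red_Cons_E[OF that(7) that(3,4)] sym by blast
    then have "q \<approx> hd q # q'" using eqv_under[OF _ eqv_sym[OF that(3)], of q "hd q"] that(4) by simp
    from adj_down[OF that(6) this] show ?thesis using that(7) red_not_Nil by blast
  qed
  have level_down: "adj q q'" if "q \<approx> hd q # s" "p \<approx> hd p # s" "s \<noteq> []" "p \<approx> hd p # q'" 
      "E (hd q) (hd q')" "red q" "red q'" for q q' s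
  proof -
    have q'n: "q' \<noteq> []" using that by auto
    show ?thesis
    proof (rule two_parents[OF r(1) that(2,4,3)])
      assume "s = [b]" "q' = [b]"
      then show ?thesis using that(1) adj_down[OF that(6) _ q'n] by auto
    next
      fix u t assume t: "s \<approx> hd s # u # t" "q' \<approx> hd q' # u # t"
      have "q \<approx> hd q # hd s # u # t" using eqv_under[OF that(1) t(1)] .
      from eqv_retop[OF that(6) this that(5)] have "q \<approx> hd q # hd q' # u # t"
        using red_Cons_E[OF that(7) t(2)] sym[of u "hd q'"] by simp
      from eqv_under[OF this eqv_sym[OF t(2)]] show ?thesis
        by (rule adj_down[OF that(6) _ q'n])
    qed
  qed
  from assms(1) show ?thesis
  proof (cases rule: adj_cases)
    case up
    note q = this
    from assms(2) show ?thesis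
    proof (cases rule: adj_cases)
      case up
      from adj_level[OF r(2,3) q this n(1) E] show ?thesis .
    next
      case down
      from up_down[OF q this E r(2,3)] show ?thesis ..
    next
      case (level s)
      from up_level[OF q level(2,3,1) E r(2,3)] show ?thesis .
    qed
  next
    case down
    note q = this
    from assms(2) show ?thesis
    proof (cases rule: adj_cases)
      case up
      from up_down[OF this q sym[OF E] r(3,2)] show ?thesis ..
    next
      case down
      show ?thesis
      proof (rule two_parents[OF r(1) q down n(2)])
        assume "q = [b]" "q' = [b]"
        then show ?thesis using E irrefl by simp
      next
        fix u t assume "q \<approx> hd q # u # t" "q' \<approx> hd q' # u # t"
        from adj_level[OF r(2,3) this _ E] show ?thesis by simp
      qed
    next
      case (level s)
      from level_down[OF level(3,2,1) q sym[OF E] r(3,2)] show ?thesis by (rule adj_sym)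
    qed
  next
    case (level s)
    note q = this
    from assms(2) show ?thesis
    proof (cases rule: adj_cases)
      case up
      from up_level[OF this q(2,3,1) sym[OF E] r(3,2)] show ?thesis by (rule adj_sym)
    next
      case down
      from level_down[OF q(3,2,1) this E r(2,3)] show ?thesis .
    next
      case (level s')
      show ?thesis
      proof (rule two_parents[OF r(1) q(2) level(2) q(1)])
        assume "s = [b]" "s' = [b]"
        then show ?thesis using adj_level[OF r(2,3) q(3) _ q(1) E] level(3) by simp
      next
        fix u t assume t: "s \<approx> hd s # u # t" "s' \<approx> hd s' # u # t"
        have e: "q \<approx> hd q # hd s # u # t" "q' \<approx> hd q' # hd s' # u # t"
          using eqv_under[OF q(3) t(1)] eqv_under[OF level(3) t(2)] by auto
        obtain c where c: "E c u" "E c (hd q)" "E c (hd q')"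
          using triangle[OF E eqv_far2(2)[OF r(2) e(1)] eqv_far2(2)[OF r(3) e(2)]] by blast
        from adj_level[OF r(2,3) eqv_retop[OF r(2) e(1) sym[OF c(2)] c(1)]
            eqv_retop[OF r(3) e(2) sym[OF c(3)] c(1)] _ E] show ?thesis by simp
      qed
    qed
  qed
qed

text \<open>
  A square is lifted by cases on which of its edges change the length of the walk. Every case is
  reduced to the one where the two lifted neighbours extend the same shorter walk.
\<close>

lemma adj_square_parent:
  assumes "red q" "red q'" "q \<approx> y # t" "q' \<approx> y' # t" "t \<noteq> []"
    and z: "E z y" "E z y'" "adj q s" "hd s = z"
  shows "adj q' s"
proof -
  have y: "hd q = y" "hd q' = y'" using assms eqv_hd by fastforce+
  have Eu: "E (hd t) y" "E (hd t) y'" and red_t: "red t"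
    using red_Cons_E assms by blast+
  have red_s: "red s" using adjD(2)[OF z(3)] .
  have tq: "adj t q" "adj t q'" using adj_up assms by blast+
  have t: "t = hd t # tl t" using assms(5) by simp
  \<comment> \<open>Four degenerate positions are settled by uniqueness and by lifted triangles; the
    last alternative is a genuine induced square.\<close>
  consider "y = y'" | "E y y'" | "z = hd t" | "E (hd t) z"
    | "y \<noteq> y'" "\<not> E y y'" "far2 E (hd t) z"
    using Eu z sym unfolding far2_def by blast
  then show ?thesis
  proof cases
    case 1
    then have "q \<approx> q'" using assms eqv_common by blast
    then show ?thesis using adj_eqv z by blast
  next
    case 2
    then have "adj q q'" using adj_triangle[OF tq] y by simp
    from adj_triangle[OF this z(3)] show ?thesis using y z sym by blast
  next
    case 3
    then have "t \<approx> s" using adj_unique[OF adj_sym[OF tq(1)] z(3)] z by simp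
    then show ?thesis using adj_eqv[OF adj_sym[OF tq(2)]] by blast
  next
    case 4
    obtain s0 where s0: "adj t s0" "hd s0 = z" using adj_exists[OF red_t 4] by blast
    have a: "adj q s0" "adj q' s0"
      using adj_triangle[OF tq(1) s0(1)] adj_triangle[OF tq(2) s0(1)] y s0 z sym by blast+
    have "s0 \<approx> s" using adj_unique[OF a(1) z(3) s0(2) z(4)] .
    then show ?thesis using adj_eqv a by blast
  next
    case 5
    note f = this(3)
    from z(3) show ?thesis
    proof (cases rule: adj_cases)
      case up
      then have "s \<approx> z # y # hd t # tl t" using z(4) eqv_under[OF _ assms(3)] t by simp
      from eqv_retop[OF red_s this z(2)] have "s \<approx> z # y' # t" using Eu sym t by simp
      from eqv_under[OF this eqv_sym[OF assms(4)]] show ?thesis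
        using adj_up[OF red_s] assms(2) red_not_Nil by blast
    next
      case down
      then have ds: "q \<approx> y # s" using y by simp
      show ?thesis
      proof (rule two_parents[OF assms(1,3) ds assms(5)])
        assume "t = [b]" "s = [b]"
        then show ?thesis using f z by (simp add: far2_def)
      next
        fix w e assume e: "t \<approx> hd t # w # e" "s \<approx> hd s # w # e"
        have "q' \<approx> y' # hd t # w # e" using eqv_under[OF assms(4) e(1)] .
        from eqv_retop[OF assms(2) this sym[OF z(2)]] have "q' \<approx> y' # hd s # w # e"
          using red_Cons_E[OF red_s e(2)] sym[of w "hd s"] z(4) by simp
        from eqv_under[OF this eqv_sym[OF e(2)]] show ?thesis
          using adj_down[OF assms(2)] red_s red_not_Nil by blast
      qed
    next
      case (level r)
      then have ds: "q \<approx> y # r" "s \<approx> z # r" using y z by simp_all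
      show ?thesis
      proof (rule two_parents[OF assms(1,3) ds(1) assms(5)])
        assume "t = [b]" "r = [b]"
        then have "E (hd t) z" using red_Cons_E[OF red_s ds(2)] by simp
        then show ?thesis using f by (simp add: far2_def)
      next
        fix w e assume e: "t \<approx> hd t # w # e" "r \<approx> hd r # w # e"
        note e1 = eqv_under[OF assms(4) e(1)] and e2 = eqv_under[OF ds(2) e(2)]
        obtain c where c: "E c w" "E c z" "E c y'"
          using triangle[OF z(2) eqv_far2(2)[OF red_s e2] eqv_far2(2)[OF assms(2) e1]] by blast
        from adj_level[OF assms(2) red_s eqv_retop[OF assms(2) e1 sym[OF c(3)] c(1)]
            eqv_retop[OF red_s e2 sym[OF c(2)] c(1)] _ sym[OF z(2)]]
        show ?thesis by simp
      qed
    qed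
  qed
qed

text \<open>Here \<open>q\<close> lies two edges above \<open>t\<close> and \<open>q'\<close> only
  one. The middle vertex \<open>c\<close> is exchanged for one that suits \<open>z\<close>: for
  \<open>z\<close> itself if it is adjacent to \<open>hd t\<close>, else for the \<open>g\<close>
  obtained from the triangle condition at \<open>hd t\<close>. What then remains, between
  \<open>g # t\<close> and \<open>q'\<close>, is a square with common parent
  \<open>t\<close>.\<close>

lemma adj_square_detour:
  assumes "red q" "red q'" "q \<approx> y # c # t" "q' \<approx> y' # t" "t \<noteq> []"
    and z: "E z y" "E z y'" "adj q s" "hd s = z"
  shows "adj q' s"
proof -
  have y: "hd q = y" "hd q' = y'" using assms eqv_hd by fastforce+
  have red_s: "red s" using adjD(2)[OF z(3)] .
  have Eu: "E (hd t) y'" using red_Cons_E assms by blast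
  have "q \<approx> y # c # hd t # tl t" using assms by simp
  note f = eqv_far2[OF assms(1) this] and ret = eqv_retop[OF assms(1) this]
  have near: "adj q (g # t)" "red (g # t)" "q \<approx> y # g # t" if "E g (hd t)" "E g y" for g
  proof -
    show e: "q \<approx> y # g # t" using ret[OF sym[OF that(2)] that(1)] assms(5) by simp
    show "adj q (g # t)" using adj_down[OF assms(1) e] by simp
    then show "red (g # t)" by (rule adjD)
  qed
  consider "E z (hd t)" | "far2 E (hd t) z"
    using f Eu z sym unfolding far2_def by blast
  then show ?thesis
  proof cases
    case 1
    have "s \<approx> z # t" using adj_unique[OF z(3) near(1)[OF 1 z(1)] z(4)] by simp
    from adj_level[OF assms(2) red_s assms(4) this assms(5) sym[OF z(2)]] show ?thesis .
  next
    case 2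
    obtain g where g: "E g (hd t)" "E g z" "E g y"
      using triangle[OF z(1) 2 f(2)] by blast
    note n = near[OF g(1,3)]
    have "adj (g # t) s" using adj_triangle[OF n(1) z(3)] g z by simp
    from adj_square_parent[OF n(2) assms(2) rtranclp.rtrancl_refl assms(4,5) sym[OF g(2)] z(2) this z(4)]
    show ?thesis .
  qed
qed

context
  fixes p q q' s x y y' z
  assumes hds: "hd p = x" "hd q = y" "hd q' = y'" "hd s = z"
    and adj: "adj p q" "adj p q'" "adj q s"
    and square: "y \<noteq> y'" "\<not> E y y'" "x \<noteq> z" "\<not> E x z" "E z y" "E z y'"
begin

lemma adj_square_up:
  assumes up: "q \<approx> y # p"
  shows "adj q' s"
proof -
  note r = adjD(1)[OF adj(1)] adjD(2)[OF adj(1)] adjD(2)[OF adj(2)] adjD(2)[OF adj(3)]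
  have n: "p \<noteq> []" "q' \<noteq> []" using r red_not_Nil by auto
  from adj(2) show ?thesis
  proof (cases rule: adj_cases)
    case up': up
    from adj_square_parent[OF r(2,3) up _ n(1) square(5,6) adj(3) hds(4)] up' hds
    show ?thesis by simp
  next
    case down
    have "q \<approx> y # x # y' # tl q'"
      using eqv_under[OF up down] hds n by (cases q') auto
    from eqv_retop[OF r(2) this sym[OF square(5)] square(6)]
    have e: "q \<approx> y # z # q'" using hds n by (cases q') auto
    have "s \<approx> z # q'"
      using adj_unique[OF adj(3) adj_down[OF r(2) e] hds(4)] by simp
    then show ?thesis using adj_up r n by blast
  next
    case (level t)
    have "q \<approx> y # x # t" using eqv_under[OF up level(2)] hds by simp
    from adj_square_detour[OF r(2,3) this _ level(1) square(5,6) adj(3) hds(4)] level hds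
    show ?thesis by simp
  qed
qed

text \<open>If \<open>q'\<close> is level as well, the parents of \<open>q\<close> and
  \<open>q'\<close> have a common ancestor \<open>u\<close>, and the distance from \<open>u\<close>
  to the opposite corner \<open>z\<close> decides. Adjacent: \<open>z\<close> becomes the middle
  vertex of both walks. Distance 2: the triangle condition splits the square into a detour and a
  triangle. Beyond: the quadrangle condition creates a common parent.\<close>

lemma adj_square_level:
  assumes lev: "p \<approx> x # r" "q \<approx> y # r" "r \<noteq> []" and not_up: "\<not> q' \<approx> y' # p"
  shows "adj q' s"
proof -
  note r = adjD(1)[OF adj(1)] adjD(2)[OF adj(1)] adjD(2)[OF adj(2)] adjD(2)[OF adj(3)]
  from adj(2) show ?thesis
  proof (cases rule: adj_cases)
    case up
    then show ?thesis using not_up hds by simp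
  next
    case down
    then have d: "p \<approx> x # q'" using hds by simp
    show ?thesis
    proof (rule two_parents[OF r(1) lev(1) d lev(3)])
      assume "r = [b]" "q' = [b]"
      then have "E y' y" using red_Cons_E[OF r(2) lev(2,3)] hds by simp
      then show ?thesis using square sym by blast
    next
      fix w e assume e: "r \<approx> hd r # w # e" "q' \<approx> hd q' # w # e"
      from adj_square_detour[OF r(2,3) eqv_under[OF lev(2) e(1)] e(2) _ square(5) _ adj(3) hds(4)]
      show ?thesis using hds square by simp
    qed
  next
    case (level r')
    then have lev': "p \<approx> x # r'" "q' \<approx> y' # r'" using hds by auto
    show ?thesis
    proof (rule two_parents[OF r(1) lev(1) lev'(1) lev(3)])
      assume "r = [b]" "r' = [b]"
      then show ?thesis
        using adj_square_parent[OF r(2,3) lev(2) _ lev(3) square(5,6) adj(3) hds(4)] lev' by simp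
    next
      fix u t assume t: "r \<approx> hd r # u # t" "r' \<approx> hd r' # u # t"
      note e = eqv_under[OF lev(2) t(1)] and e' = eqv_under[OF lev'(2) t(2)]
      note f = eqv_far2[OF r(2) e] and f' = eqv_far2[OF r(3) e']
      consider "E z u" | "far2 E u z" | "beyond2 E u z"
        using f square sym unfolding far2_def beyond2_def by blast
      then show ?thesis
      proof cases
        case 1
        from adj_down[OF r(2) eqv_retop[OF r(2) e sym[OF square(5)] 1]]
        have "s \<approx> z # u # t" using adj_unique[OF adj(3) _ hds(4)] by simp
        from eqv_under[OF eqv_retop[OF r(3) e' sym[OF square(6)] 1] eqv_sym[OF this]]
        show ?thesis using adj_down[OF r(3)] r(4) red_not_Nil by blast
      next
        case 2
        obtain g where g: "E g u" "E g z" "E g y'"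
          using triangle[OF square(6) 2 f'(2)] by blast
        have a: "adj q' (g # u # t)"
          using adj_down[OF r(3) eqv_retop[OF r(3) e' sym[OF g(3)] g(1)]] by simp
        have "adj (g # u # t) s"
          using adj_square_detour[OF r(2) adjD(2)[OF a] e rtranclp.rtrancl_refl _ square(5) sym[OF g(2)] adj(3) hds(4)]
          by simp
        from adj_triangle[OF adj_sym[OF a] this] show ?thesis using hds square sym by blast
      next
        case 3
        obtain g where g: "E g u" "E g y" "E g y'"
          using quadrangle[OF square(5,6) f(2) f'(2) 3] by blast
        from adj_square_parent[OF r(2,3) eqv_retop[OF r(2) e sym[OF g(2)] g(1)]
            eqv_retop[OF r(3) e' sym[OF g(3)] g(1)] _ square(5,6) adj(3) hds(4)]
        show ?thesis by simp
      qed
    qed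
  qed
qed

end

text \<open>Reading the square from \<open>q\<close> instead of \<open>p\<close> turns down into up,
  and exchanges the roles of \<open>q'\<close> and \<open>s\<close>. After this symmetry the
  remaining case has \<open>p\<close>, \<open>q\<close> level with \<open>q'\<close> and
  \<open>s\<close> above them, and the triangle condition at the end of their common parent closes
  the square.\<close>

lemma adj_square:
  assumes hds: "hd p = x" "hd q = y" "hd q' = y'" "hd s = z"
    and adj: "adj p q" "adj p q'" "adj q s"
    and square: "y \<noteq> y'" "\<not> E y y'" "x \<noteq> z" "\<not> E x z" "E z y" "E z y'"
  shows "adj q' s"
proof -
  note r = adjD(1)[OF adj(1)] adjD(2)[OF adj(1)] adjD(2)[OF adj(2)] adjD(2)[OF adj(3)]
  have E': "E y' x" "E y' z" "\<not> E z x" "\<not> E y' y"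
    using adjD(3)[OF adj(2)] hds square sym by auto
  note rev = hds(2,1,4,3) adj_sym[OF adj(1)] adj(3) adj(2) square(3,4) square(1,2) E'(1,2)
  from adj(1) show ?thesis
  proof (cases rule: adj_cases)
    case up
    then show ?thesis using adj_square_up[OF hds adj square] hds by simp
  next
    case down
    then show ?thesis using adj_square_up[OF rev] adj_sym hds by simp
  next
    case (level t)
    then have lev: "p \<approx> x # t" "q \<approx> y # t" using hds by auto
    show ?thesis
    proof (cases "q' \<approx> y' # p")
      case False
      from adj_square_level[OF hds adj square lev level(1) False] show ?thesis .
    next
      case up': True
      show ?thesis
      proof (cases "s \<approx> z # q")
        case False
        from adj_square_level[OF rev lev(2,1) level(1) False] show ?thesis by (rule adj_sym)
      next
        case True
        have e: "s \<approx> z # y # hd t # tl t" "q' \<approx> y' # x # hd t # tl t"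
          using eqv_under[OF True lev(2)] eqv_under[OF up' lev(1)] level(1) by auto
        obtain c where c: "E c (hd t)" "E c z" "E c y'"
          using triangle[OF square(6) eqv_far2(2)[OF r(4) e(1)] eqv_far2(2)[OF r(3) e(2)]] by blast
        from adj_level[OF r(3,4) eqv_retop[OF r(3) e(2) sym[OF c(3)] c(1)]
            eqv_retop[OF r(4) e(1) sym[OF c(2)] c(1)] _ E'(2)]
        show ?thesis by simp
      qed
    qed
  qed
qed

section \<open>Lifting walks, and invariance of the lift under homotopy\<close>

text \<open>The walk is listed from \<open>b\<close> onwards, its lift from the current vertex
  backwards. A relation is used because a lift is determined only up to \<open>eqv\<close>.\<close>

inductive lifts :: "'a list \<Rightarrow> 'a list \<Rightarrow> bool" where
  lifts_base: "lifts [b] [b]"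
| lifts_snoc: "\<lbrakk>lifts xs p; adj p q\<rbrakk> \<Longrightarrow> lifts (xs @ [hd q]) q"

text \<open>Lifting never lengthens a walk; this bound later identifies the lifts of shortest walks
  as geodesics.\<close>

lemma lifts_props: "lifts xs p \<Longrightarrow> xs \<noteq> [] \<and> red p \<and> last xs = hd p \<and> length p \<le> length xs"
proof (induction rule: lifts.induct)
  case lifts_base
  show ?case by (simp add: red_base)
next
  case (lifts_snoc xs p q)
  have "length q \<le> Suc (length p)"
    using lifts_snoc(2)
  proof (cases rule: adj_cases)
    case (level r)
    then show ?thesis using eqv_length[OF level(2)] eqv_length[OF level(3)] by simp
  qed (auto dest: eqv_length)
  then show ?case using lifts_snoc adjD(2) by auto
qed

lemma lifts_snocE:
  assumes "lifts (xs @ [y]) q" "xs \<noteq> []"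
  obtains p where "lifts xs p" "adj p q" "hd q = y"
  using assms by (cases rule: lifts.cases) auto

lemma lifts_exists: "\<lbrakk>xs \<noteq> []; hd xs = b; successively E xs\<rbrakk> \<Longrightarrow> \<exists>p. lifts xs p"
proof (induction xs rule: rev_induct)
  case (snoc y xs)
  show ?case
  proof (cases "xs = []")
    case True
    then show ?thesis using snoc lifts_base by auto
  next
    case False
    then obtain p where p: "lifts xs p"
      using snoc by (auto simp: successively_append_iff)
    have "E (last xs) y" using snoc False by (auto simp: successively_append_iff)
    then obtain q where "adj p q" "hd q = y" using adj_exists lifts_props[OF p] by auto
    then show ?thesis using lifts_snoc[OF p] by blast
  qed
qed simp

lemma lifts_append:
  assumes "xs \<noteq> []" "xs' \<noteq> []" "\<And>p q. \<lbrakk>lifts xs p; lifts xs' q\<rbrakk> \<Longrightarrow> p \<approx> q"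
  shows "\<lbrakk>lifts (xs @ ys) p; lifts (xs' @ ys) q\<rbrakk> \<Longrightarrow> p \<approx> q"
proof (induction ys arbitrary: p q rule: rev_induct)
  case Nil
  then show ?case using assms by simp
next
  case (snoc y ys)
  obtain p' where p': "lifts (xs @ ys) p'" "adj p' p" "hd p = y"
    using lifts_snocE[of "xs @ ys" y p] snoc.prems assms by auto
  obtain q' where q': "lifts (xs' @ ys) q'" "adj q' q" "hd q = y"
    using lifts_snocE[of "xs' @ ys" y q] snoc.prems assms by auto
  have "adj p' q" using adj_eqv[OF q'(2) eqv_sym[OF snoc.IH[OF p'(1) q'(1)]]] by simp
  from adj_unique[OF p'(2) this] show ?case using p' q' by simp
qed

lemma lifts_unique: "\<lbrakk>lifts xs p; lifts xs q\<rbrakk> \<Longrightarrow> p \<approx> q"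
proof -
  assume a: "lifts xs p" "lifts xs q"
  have "p = [b]" if "lifts [x] p" for x p
    using that by (cases rule: lifts.cases) (auto dest: lifts_props)
  then have "p \<approx> q" if "lifts [x] p" "lifts [x] q" for x p q using that by blast
  from lifts_append[of "[hd xs]" "[hd xs]" "tl xs" p q, OF _ _ this] show ?thesis
    using a lifts_props[OF a(1)] by simp
qed

lemma hstep_lifts:
  assumes "hstep E xs ys" "lifts xs p" "lifts ys q"
  shows "p \<approx> q"
  using assms(1) unfolding hstep_def
proof (elim disjE exE conjE)
  fix as bs x y assume e: "xs = as @ [x, y, x] @ bs" "ys = as @ [x] @ bs"
  have "p \<approx> q" if h: "lifts (as @ [x, y, x]) p" "lifts (as @ [x]) q" for p q
  proof -
    obtain p1 where p1: "lifts (as @ [x, y]) p1" "adj p1 p" "hd p = x"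
      using lifts_snocE[of "as @ [x, y]" x p] h by auto
    obtain p0 where p0: "lifts (as @ [x]) p0" "adj p0 p1"
      using lifts_snocE[of "as @ [x]" y p1] p1 by auto
    have "hd p0 = x" using lifts_props[OF p0(1)] by simp
    then have "p \<approx> p0" using adj_unique[OF p1(2) adj_sym[OF p0(2)]] p1 by simp
    then show ?thesis using lifts_unique[OF p0(1) h(2)] eqv_trans by blast
  qed
  from lifts_append[of "as @ [x, y, x]" "as @ [x]" bs p q, OF _ _ this] show ?thesis
    using e assms by simp
next
  fix as bs x y z assume e: "xs = as @ [x, y, z] @ bs" "ys = as @ [x, z] @ bs"
    and E: "E x y" "E y z" "E x z"
  have "p \<approx> q" if h: "lifts (as @ [x, y, z]) p" "lifts (as @ [x, z]) q" for p q
  proof -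
    obtain p1 where p1: "lifts (as @ [x, y]) p1" "adj p1 p" "hd p = z"
      using lifts_snocE[of "as @ [x, y]" z p] h by auto
    obtain p0 where p0: "lifts (as @ [x]) p0" "adj p0 p1"
      using lifts_snocE[of "as @ [x]" y p1] p1 by auto
    obtain q0 where q0: "lifts (as @ [x]) q0" "adj q0 q" "hd q = z"
      using lifts_snocE[of "as @ [x]" z q] h by auto
    have "hd p0 = x" using lifts_props[OF p0(1)] by simp
    then have "adj p0 p" using adj_triangle[OF adj_sym[OF p0(2)] p1(2)] E p1 by simp
    moreover have "adj p0 q" using adj_eqv[OF q0(2) lifts_unique[OF q0(1) p0(1)]] by simp
    ultimately show ?thesis using adj_unique p1 q0 by blast
  qed
  from lifts_append[of "as @ [x, y, z]" "as @ [x, z]" bs p q, OF _ _ this] show ?thesis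
    using e assms by simp
next
  fix as bs x y z w assume e: "xs = as @ [x, y, z] @ bs" "ys = as @ [x, w, z] @ bs"
    and sq: "induced_square E x y z w"
  have "p \<approx> q" if h: "lifts (as @ [x, y, z]) p" "lifts (as @ [x, w, z]) q" for p q
  proof -
    obtain p1 where p1: "lifts (as @ [x, y]) p1" "adj p1 p" "hd p = z"
      using lifts_snocE[of "as @ [x, y]" z p] h by auto
    obtain p0 where p0: "lifts (as @ [x]) p0" "adj p0 p1" "hd p1 = y"
      using lifts_snocE[of "as @ [x]" y p1] p1 by auto
    obtain q1 where q1: "lifts (as @ [x, w]) q1" "adj q1 q" "hd q = z"
      using lifts_snocE[of "as @ [x, w]" z q] h by auto
    obtain q0 where q0: "lifts (as @ [x]) q0" "adj q0 q1" "hd q1 = w"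
      using lifts_snocE[of "as @ [x]" w q1] q1 by auto
    have x: "hd p0 = x" using lifts_props[OF p0(1)] by simp
    have a: "adj p0 q1" using adj_eqv[OF q0(2) lifts_unique[OF q0(1) p0(1)]] by simp
    have E: "E z y" "E z w" "y \<noteq> w" "\<not> E y w" "x \<noteq> z" "\<not> E x z"
      using sq sym unfolding induced_square_def by auto
    have "adj q1 p"
      using adj_square[OF x p0(3) q0(3) p1(3) p0(2) a p1(2) E(3-6) E(1,2)] .
    then show ?thesis using adj_unique q1 p1 by blast
  qed
  from lifts_append[of "as @ [x, y, z]" "as @ [x, w, z]" bs p q, OF _ _ this] show ?thesis
    using e assms by simp
qed

text \<open>Each further vertex is a step up, so a reduced walk is its own normal form. With
  \<open>homotopic_lifts\<close>, homotopic reduced walks differ by swaps alone.\<close>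

lemma red_lifts: "red p \<Longrightarrow> lifts (rev p) p"
proof (induction p)
  case (Cons x p)
  show ?case
  proof (cases "p = []")
    case True
    then show ?thesis using red_rwalk[OF Cons.prems] lifts_base by simp
  next
    case False
    have "adj p (x # p)" using adj_up[OF Cons.prems rtranclp.rtrancl_refl False] .
    then show ?thesis using lifts_snoc[of "rev p" p "x # p"] Cons.IH red_tl[OF Cons.prems False] by simp
  qed
qed simp

lemma homotopic_lifts:
  assumes "\<And>xs. walk V E xs \<Longrightarrow> xs \<noteq> [] \<and> successively E xs"
    and "homotopic V E xs ys" "lifts xs p" "lifts ys q" "hd xs = b"
  shows "p \<approx> q"
proof -
  have "hd ys = b \<and> (\<forall>q. lifts ys q \<longrightarrow> p \<approx> q)"
    using assms(2) unfolding homotopic_def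
  proof (induction rule: rtranclp_induct)
    case base
    show ?case using assms lifts_unique by blast
  next
    case (step ys zs)
    then have h: "hd zs = b" using hstep_hd by metis
    obtain r where r: "lifts ys r" using lifts_exists[of ys] assms(1)[of ys] step by blast
    have "p \<approx> q" if q: "lifts zs q" for q
    proof -
      have "r \<approx> q" using step hstep_lifts r q eqv_sym by blast
      then show ?thesis using step r eqv_trans by blast
    qed
    then show ?case using h by blast
  qed
  then show ?thesis using assms by blast
qed

end

section \<open>From local to global weak modularity\<close>

locale cgraph =
  fixes V :: "'a set" and E :: "'a \<Rightarrow> 'a \<Rightarrow> bool"
  assumes conn: "connected_graph V E"
begin

abbreviation d :: "'a \<Rightarrow> 'a \<Rightarrow> nat" where "d \<equiv> dist V E"
abbreviation I :: "'a \<Rightarrow> 'a \<Rightarrow> 'a set" where "I \<equiv> interval V E"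

lemma E_V: "E x y \<Longrightarrow> x \<in> V" "E x y \<Longrightarrow> y \<in> V"
  and E_sym: "E x y \<Longrightarrow> E y x"
  and E_neq: "E x y \<Longrightarrow> x \<noteq> y"
  and E_irrefl: "\<not> E x x"
  using conn unfolding connected_graph_def graph_def by blast+

lemma walk_iff: "walk V E xs \<longleftrightarrow> xs \<noteq> [] \<and> set xs \<subseteq> V \<and> successively E xs"
  unfolding walk_def successively_conv_nth by auto

lemma walk_append:
  "\<lbrakk>xs \<noteq> []; ys \<noteq> []\<rbrakk> \<Longrightarrow> walk V E (xs @ ys) \<longleftrightarrow> walk V E xs \<and> walk V E ys \<and> E (last xs) (hd ys)"
  by (auto simp: walk_iff successively_append_iff)

lemma walk_single [simp]: "walk V E [x] \<longleftrightarrow> x \<in> V"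
  by (auto simp: walk_iff)

lemma walk_Cons [simp]: "walk V E (x # y # xs) \<longleftrightarrow> E x y \<and> walk V E (y # xs)"
  using E_V by (auto simp: walk_iff)

lemma walk_join:
  assumes "walk V E xs" "walk V E ys" "last xs = hd ys"
  shows "walk V E (xs @ tl ys)" "hd (xs @ tl ys) = hd xs" "last (xs @ tl ys) = last ys"
    "length (xs @ tl ys) = length xs + length ys - 1"
proof -
  have ne: "xs \<noteq> []" "ys \<noteq> []" using assms by (auto simp: walk_iff)
  then show "hd (xs @ tl ys) = hd xs" "length (xs @ tl ys) = length xs + length ys - 1" 
    by (auto simp: Suc_leI)
  show "last (xs @ tl ys) = last ys" using assms ne by (cases ys) auto
  show "walk V E (xs @ tl ys)"
  proof (cases "tl ys")
    case Nil
    then show ?thesis using assms by simp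
  next
    case (Cons y zs)
    note y = this
    then have ys: "ys = hd ys # y # zs" using ne by (cases ys) auto
    then have "walk V E (y # zs)" "E (hd ys) y" using assms walk_Cons by metis+
    then show ?thesis using y ne assms by (simp add: walk_append)
  qed
qed

lemma walk_rev: "walk V E xs \<Longrightarrow> walk V E (rev xs)"
  by (auto simp: walk_iff successively_rev intro: successively_mono E_sym)

lemma dist_le: "walk V E xs \<Longrightarrow> d (hd xs) (last xs) \<le> length xs - 1"
  unfolding dist_def by (rule Least_le) (auto simp: walk_iff)

lemma dist_walk:
  assumes "u \<in> V" "v \<in> V"
  obtains xs where "walk V E xs" "hd xs = u" "last xs = v" "length xs = Suc (d u v)"
proof -
  obtain xs where "walk V E xs" "hd xs = u" "last xs = v"
    using conn assms unfolding connected_graph_def by blast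
  then have "\<exists>n. \<exists>xs. walk V E xs \<and> hd xs = u \<and> last xs = v \<and> length xs = Suc n"
    by (metis walk_iff length_greater_0_conv Suc_pred)
  from LeastI_ex[OF this] show ?thesis using that unfolding dist_def by blast
qed

lemma dist_triangle:
  assumes "u \<in> V" "v \<in> V" "w \<in> V"
  shows "d u w \<le> d u v + d v w"
proof -
  obtain xs where xs: "walk V E xs" "hd xs = u" "last xs = v" "length xs = Suc (d u v)"
    using dist_walk assms by blast
  obtain ys where ys: "walk V E ys" "hd ys = v" "last ys = w" "length ys = Suc (d v w)"
    using dist_walk assms by blast
  show ?thesis using dist_le[OF walk_join(1)[OF xs(1) ys(1)]] walk_join[OF xs(1) ys(1)] xs ys by auto
qed

lemma dist_sym: "u \<in> V \<Longrightarrow> v \<in> V \<Longrightarrow> d u v = d v u"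
proof -
  have "d v u \<le> d u v" if uv: "u \<in> V" "v \<in> V" for u v
  proof -
    obtain xs where xs: "walk V E xs" "hd xs = u" "last xs = v" "length xs = Suc (d u v)"
      using dist_walk uv by blast
    show ?thesis using dist_le[OF walk_rev[OF xs(1)]] xs by (auto simp: hd_rev last_rev)
  qed
  then show "u \<in> V \<Longrightarrow> v \<in> V \<Longrightarrow> d u v = d v u" by (simp add: antisym)
qed

lemma dist_self [simp]: "u \<in> V \<Longrightarrow> d u u = 0"
  using dist_le[of "[u]"] by simp

lemma dist_0: "u \<in> V \<Longrightarrow> v \<in> V \<Longrightarrow> d u v = 0 \<longleftrightarrow> u = v"
proof -
  assume uv: "u \<in> V" "v \<in> V"
  obtain xs where xs: "walk V E xs" "hd xs = u" "last xs = v" "length xs = Suc (d u v)"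
    using dist_walk uv by blast
  show ?thesis
  proof
    assume "d u v = 0"
    then obtain x where "xs = [x]" using xs by (auto simp: length_Suc_conv)
    then show "u = v" using xs by simp
  qed (use uv in simp)
qed

lemma dist_Suc:
  assumes "u \<in> V" "v \<in> V" "d u v = Suc n"
  obtains w where "E w v" "d u w = n" "w \<in> V"
proof -
  obtain xs where xs: "walk V E xs" "hd xs = u" "last xs = v" "length xs = Suc (d u v)"
    using dist_walk assms by blast
  have ne: "xs \<noteq> []" using xs by auto
  let ?ys = "butlast xs"
  have ys: "?ys \<noteq> []" "length ?ys = Suc n" using xs assms by (auto simp: butlast_conv_take)
  have "xs = ?ys @ [v]" using ne xs by (metis append_butlast_last_id)
  then have w: "walk V E ?ys" "E (last ?ys) v" "hd ?ys = u"
    using walk_append[OF ys(1), of "[v]"] xs ys by (auto simp: hd_append dest: arg_cong[where f=hd])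
  then have "d u (last ?ys) \<le> n" using dist_le[OF w(1)] ys by simp
  moreover have "d (last ?ys) v \<le> 1" using dist_le[of "[last ?ys, v]"] w E_V by auto
  moreover have "Suc n \<le> d u (last ?ys) + d (last ?ys) v"
    using dist_triangle[of u "last ?ys" v] assms w E_V by metis
  ultimately have "d u (last ?ys) = n" by simp
  then show ?thesis using that w E_V by blast
qed

lemma dist_1: "u \<in> V \<Longrightarrow> v \<in> V \<Longrightarrow> d u v = 1 \<longleftrightarrow> E u v"
proof
  assume uv: "u \<in> V" "v \<in> V" "d u v = 1"
  then obtain w where "E w v" "d u w = 0" "w \<in> V" using dist_Suc[of u v 0] by auto
  then show "E u v" using dist_0 uv by blast
next
  assume uv: "u \<in> V" "v \<in> V" "E u v"
  then have "d u v \<le> 1" using dist_le[of "[u, v]"] by simp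
  moreover have "d u v \<noteq> 0" using uv E_neq dist_0 by blast
  ultimately show "d u v = 1" by simp
qed

lemma dist_edge: "E u v \<Longrightarrow> d u v = 1"
  using dist_1 E_V by blast

lemma dist_step: "u \<in> V \<Longrightarrow> E v w \<Longrightarrow> d u w \<le> Suc (d u v)"
  using dist_triangle[of u v w] dist_edge[of v w] E_V[of v w] by simp

lemma dist_2: 
  assumes "u \<in> V" "v \<in> V" shows "d u v = 2 \<longleftrightarrow> far2 E u v"
proof
  assume d: "d u v = 2"
  then obtain w where "E w v" "d u w = 1" "w \<in> V" using dist_Suc[of u v 1] assms by auto
  then show "far2 E u v" using d dist_1[of u w] dist_1[of u v] dist_0[of u v] assms
    by (auto simp: far2_def)
next
  assume f: "far2 E u v"
  then obtain c where "E u c" "E c v" by (auto simp: far2_def)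
  then have "d u v \<le> 2" using dist_step[of u c v] dist_edge assms by simp
  moreover have "d u v \<noteq> 0" "d u v \<noteq> 1" using f dist_0 dist_1 assms by (auto simp: far2_def)
  ultimately show "d u v = 2" by simp
qed

lemma dist_ge_3:
  assumes "u \<in> V" "v \<in> V" shows "beyond2 E u v \<longleftrightarrow> 3 \<le> d u v"
proof -
  have "3 \<le> d u v \<longleftrightarrow> d u v \<noteq> 0 \<and> d u v \<noteq> 1 \<and> d u v \<noteq> 2" by auto
  then show ?thesis using dist_0 dist_1 dist_2 assms by (auto simp: far2_def beyond2_def)
qed

end

section \<open>The global triangle and quadrangle conditions\<close>

text \<open>A form of local weak modularity free of distances and of the vertex set, which can be
  verified in a cover before any distance there is known.\<close>

definition locally_wm :: "('a \<Rightarrow> 'a \<Rightarrow> bool) \<Rightarrow> bool" where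
  "locally_wm E \<longleftrightarrow> (\<forall>u v w. E v w \<longrightarrow> far2 E u v \<longrightarrow> far2 E u w \<longrightarrow> (\<exists>x. E x u \<and> E x v \<and> E x w)) \<and>
    (\<forall>u v w z. E z v \<longrightarrow> E z w \<longrightarrow> far2 E v w \<longrightarrow> far2 E u v \<longrightarrow> far2 E u w \<longrightarrow> beyond2 E u z \<longrightarrow>
      (\<exists>x. E x u \<and> E x v \<and> E x w))"

context cgraph begin

lemma far2_V: "far2 E u v \<Longrightarrow> u \<in> V \<and> v \<in> V"
  using E_V unfolding far2_def by blast

lemma locally_wm:
  assumes "locally_weakly_modular V E" shows "locally_wm E"
  unfolding locally_wm_def
proof (intro conjI allI impI)
  fix u v w assume a: "E v w" "far2 E u v" "far2 E u w"
  then have V: "u \<in> V" "v \<in> V" "w \<in> V" using far2_V by blast+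
  have "LTC V E u" using assms V unfolding locally_weakly_modular_def by blast
  then show "\<exists>x. E x u \<and> E x v \<and> E x w"
    using a V dist_2[OF V(1,2)] dist_2[OF V(1,3)] unfolding LTC_def by blast
next
  fix u v w z
  assume a: "E z v" "E z w" "far2 E v w" "far2 E u v" "far2 E u w" "beyond2 E u z"
  then have V: "u \<in> V" "v \<in> V" "w \<in> V" "z \<in> V" using far2_V E_V by blast+
  have 2: "d v w = 2" "d u v = 2" "d u w = 2" using a dist_2 V by blast+
  have "d u z = 3"
    using dist_ge_3[OF V(1,4)] dist_step[OF V(1) E_sym[OF a(1)]] a(6) 2 by simp
  moreover have "LQC V E u" using assms V unfolding locally_weakly_modular_def by blast
  ultimately show "\<exists>x. E x u \<and> E x v \<and> E x w"
    using a V 2 unfolding LQC_def by blast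
qed

lemma lwm:
  assumes "locally_wm E" shows "lwm E"
proof
  show "E x y \<Longrightarrow> E y x" for x y by (rule E_sym)
  show "\<not> E x x" for x by (rule E_irrefl)
  show tr: "\<exists>x. E x u \<and> E x v \<and> E x w" if "E v w" "far2 E u v" "far2 E u w" for u v w
    using that assms unfolding locally_wm_def by blast
  show "\<exists>x. E x u \<and> E x v \<and> E x w"
    if z: "E z v" "E z w" "far2 E u v" "far2 E u w" "beyond2 E u z" for u v w z
  proof -
    consider "v = w" | "E v w" | "far2 E v w"
      using z E_sym unfolding far2_def by blast
    then show ?thesis
    proof cases
      case 1
      then show ?thesis using z E_sym unfolding far2_def by blast
    next
      case 2
      then show ?thesis using tr z by blast
    next
      case 3
      then show ?thesis using z assms unfolding locally_wm_def by blast
    qed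
  qed
qed

text \<open>Phrased with two walks having the same ends instead of closed walks, since it is applied
  to pairs of reduced walks.\<close>

definition simply_connected :: bool where
  "simply_connected \<longleftrightarrow> (\<forall>p q. walk V E p \<longrightarrow> walk V E q \<longrightarrow> hd p = hd q \<longrightarrow> last p = last q \<longrightarrow>
     homotopic V E p q)"

definition TC :: bool where
  "TC \<longleftrightarrow> (\<forall>u\<in>V. \<forall>v w n. E v w \<longrightarrow> d u v = Suc n \<longrightarrow> d u w = Suc n \<longrightarrow>
     (\<exists>x. E x v \<and> E x w \<and> d u x = n))"

definition QC :: bool where
  "QC \<longleftrightarrow> (\<forall>u\<in>V. \<forall>v w z n. E z v \<longrightarrow> E z w \<longrightarrow> d u z = Suc (Suc n) \<longrightarrow> d u v = Suc n \<longrightarrow> d u w = Suc n \<longrightarrow>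
     (\<exists>x. E x v \<and> E x w \<and> d u x = n))"

lemma local_to_global:
  assumes "locally_wm E" simply_connected
  shows TC QC
proof -
  interpret lwm E b for b by (rule lwm[OF assms(1)])
  have rw: "walk V E (rev p)" "last p = b" if "rwalk b p" "b \<in> V" for b p
  proof -
    have "walk V E p \<and> last p = b" using that(1)
    proof (induction rule: rwalk.induct)
      case (step p x)
      then show ?case by (cases p) auto
    qed (use that in auto)
    then show "walk V E (rev p)" "last p = b" using walk_rev by auto
  qed
  \<comment> \<open>The only use of simple connectedness: reduced walks with the same ends are
    homotopic and lift to themselves.\<close>
  have eq: "swap\<^sup>*\<^sup>* p q" if "red b p" "red b q" "hd p = hd q" "b \<in> V" for b p q
  proof -
    have w: "rwalk b p" "rwalk b q" using that red_rwalk by auto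
    have ne: "p \<noteq> []" "q \<noteq> []" using that by auto
    have h: "homotopic V E (rev p) (rev q)"
      using assms(2) rw[OF w(1) that(4)] rw[OF w(2) that(4)] that ne
      unfolding simply_connected_def by (auto simp: hd_rev last_rev)
    show ?thesis
      by (rule homotopic_lifts[OF _ h red_lifts[OF that(1)] red_lifts[OF that(2)]])
        (use rw w that ne in \<open>auto simp: walk_iff hd_rev\<close>)
  qed
  \<comment> \<open>The lift of a shortest walk to \<open>v\<close> is no longer than that walk, and
    being itself a walk to \<open>v\<close> it is no shorter.\<close>
  have ex: "\<exists>p. red b p \<and> hd p = v \<and> length p = Suc (d b v)" if bv: "b \<in> V" "v \<in> V" for b v
  proof -
    obtain xs where xs: "walk V E xs" "hd xs = b" "last xs = v" "length xs = Suc (d b v)"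
      using dist_walk bv by blast
    then obtain p where p: "lifts b xs p" using lifts_exists[of xs b] by (auto simp: walk_iff)
    note pp = lifts_props[OF p]
    have r: "rwalk b p" using pp red_rwalk by blast
    have "d b v \<le> length p - 1"
      using dist_le[OF rw(1)[OF r bv(1)]] rw(2)[OF r bv(1)] pp xs red_not_Nil[of b p] by (simp add: hd_rev last_rev)
    moreover have "length p > 0" using pp red_not_Nil by blast
    ultimately have "length p = Suc (d b v)" using pp xs by linarith
    moreover have "hd p = v" using pp xs by simp
    ultimately show ?thesis using pp by blast
  qed
  have len: "length p = Suc (d b (hd p))" if p: "red b p" "b \<in> V" for b p
  proof -
    have "hd p \<in> V" using rw(1)[OF red_rwalk[OF that(1)] that(2)] red_not_Nil[OF that(1)]
      by (auto simp: walk_iff)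
    then obtain q where q: "red b q" "hd q = hd p" "length q = Suc (d b (hd p))" using ex p(2) by blast
    show ?thesis using eqv_length[OF eq[OF q(1) p(1) q(2) p(2)]] q(3) by simp
  qed
  have adj: "adj b p q" if pq: "red b p" "red b q" "E (hd p) (hd q)" "b \<in> V" for b p q
  proof -
    obtain q' where q': "adj b p q'" "hd q' = hd q" using adj_exists pq by blast
    from adj_eqv[OF q'(1) rtranclp.rtrancl_refl eq[OF adjD(2)[OF q'(1)] pq(2) q'(2) pq(4)]]
    show ?thesis .
  qed
  show TC unfolding TC_def
  proof (intro ballI allI impI)
    fix u v w n assume a: "u \<in> V" "E v w" "d u v = Suc n" "d u w = Suc n"
    obtain p where p: "red u p" "hd p = v" "length p = Suc (Suc n)" using ex[of u v] a E_V by metis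
    obtain q where q: "red u q" "hd q = w" "length q = Suc (Suc n)" using ex[of u w] a E_V by metis
    have "adj u p q" using adj p q a by blast
    then show "\<exists>x. E x v \<and> E x w \<and> d u x = n"
    proof (cases rule: adj_cases)
      case up
      then show ?thesis using p q eqv_length by fastforce
    next
      case down
      then show ?thesis using p q eqv_length by fastforce
    next
      \<comment> \<open>Equal lengths leave only this case; the end of the common walk
        \<open>r\<close> is the vertex sought.\<close>
      case (level r)
      have "length r = Suc n" using eqv_length[OF level(2)] p by simp
      moreover have r: "red u r" "E (hd r) v" "E (hd r) w"
        using red_Cons_E[OF p(1) level(2,1)] red_Cons_E[OF q(1) level(3,1)] p q by auto
      ultimately have "d u (hd r) = n" using len a by simp
      then show ?thesis using r by blast
    qed
  qed
  show QC unfolding QC_def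
  proof (intro ballI allI impI)
    fix u v w z n
    assume a: "u \<in> V" "E z v" "E z w" "d u z = Suc (Suc n)" "d u v = Suc n" "d u w = Suc n"
    obtain p where p: "red u p" "hd p = v" "length p = Suc (Suc n)" using ex[of u v] a E_V by metis
    obtain q where q: "red u q" "hd q = w" "length q = Suc (Suc n)" using ex[of u w] a E_V by metis
    obtain s where s: "red u s" "hd s = z" "length s = Suc (Suc (Suc n))" using ex[of u z] a E_V by metis
    have up: "swap\<^sup>*\<^sup>* s (z # p)" if "red u p" "E z (hd p)" "length p = Suc (Suc n)" for p
    proof -
      have "adj u p s" using adj that s a E_sym by metis
      then show ?thesis
      proof (cases rule: adj_cases)
        case up
        then show ?thesis using s by simp
      next
        case down
        then show ?thesis using s that eqv_length by fastforce
      next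
        case (level r)
        then show ?thesis using s that eqv_length[OF level(2)] eqv_length[OF level(3)] by simp
      qed
    qed
    \<comment> \<open>\<open>z\<close> is entered through \<open>v\<close> and through
      \<open>w\<close>, so \<open>two_parents\<close> yields the vertex two steps below
      \<open>z\<close>.\<close>
    have pq: "swap\<^sup>*\<^sup>* s (z # p)" "swap\<^sup>*\<^sup>* s (z # q)" using up p q a by auto
    show "\<exists>x. E x v \<and> E x w \<and> d u x = n"
    proof (rule two_parents[OF s(1) pq red_not_Nil[OF p(1)]])
      assume "p = [u]" then show ?thesis using p by simp
    next
      fix x t assume t: "swap\<^sup>*\<^sup>* p (hd p # x # t)" "swap\<^sup>*\<^sup>* q (hd q # x # t)"
      have "length (x # t) = Suc n" using eqv_length[OF t(1)] p by simp
      moreover have "red u (x # t)" "E x v" "E x w"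
        using red_Cons_E[OF p(1) t(1)] red_Cons_E[OF q(1) t(2)] p q by auto
      ultimately show ?thesis using len[of u "x # t"] a by auto
    qed
  qed
qed

end

section \<open>Quads and gates\<close>

text \<open>Thickness is reduced to two common neighbours at distance 2; a square inside an interval
  of length 2 always contains such a pair.\<close>

locale polar_graph = cgraph +
  assumes TC: TC and QC: QC
    and thick: "far2 E u v \<Longrightarrow> \<exists>x y. far2 E x y \<and> E u x \<and> E x v \<and> E u y \<and> E y v"
    and no_K4_minus: "\<lbrakk>E a c; E a e; E b c; E b e; E c e; a \<noteq> b\<rbrakk> \<Longrightarrow> E a b"
    and no_K33_minus: "\<lbrakk>E a1 b2; E a1 b3; E a2 b1; E a2 b2; E a2 b3; E a3 b1; E a3 b2; E a3 b3;
       beyond2 E a1 b1; far2 E a1 a2; far2 E a1 a3; far2 E a2 a3; far2 E b1 b2; far2 E b1 b3; far2 E b2 b3\<rbrakk> \<Longrightarrow> False"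
begin

lemma TC_obtain:
  assumes "u \<in> V" "E v w" "d u v = k" "d u w = k" "0 < k"
  obtains x where "E x v" "E x w" "Suc (d u x) = k" "x \<in> V"
proof -
  obtain n where "k = Suc n" using assms gr0_implies_Suc by blast
  then obtain x where "E x v" "E x w" "d u x = n" using TC assms unfolding TC_def by blast
  then show ?thesis using that \<open>k = Suc n\<close> E_V by simp
qed

lemma QC_obtain:
  assumes "u \<in> V" "E z v" "E z w" "d u z = Suc k" "d u v = k" "d u w = k" "0 < k"
  obtains x where "E x v" "E x w" "Suc (d u x) = k" "x \<in> V"
proof -
  obtain n where "k = Suc n" using assms gr0_implies_Suc by blast
  then obtain x where "E x v" "E x w" "d u x = n" using QC assms unfolding QC_def by blast
  then show ?thesis using that \<open>k = Suc n\<close> E_V by simp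
qed

lemma far2_sym: "far2 E x y \<Longrightarrow> far2 E y x"
  using E_sym unfolding far2_def by blast

lemma triangle:
  assumes "far2 E u v" "far2 E u w" "E v w"
  obtains x where "E x u" "E x v" "E x w"
proof -
  have V: "u \<in> V" "v \<in> V" "w \<in> V" using assms far2_V by blast+
  obtain x where x: "E x v" "E x w" "Suc (d u x) = 2" "x \<in> V"
    using TC_obtain[OF V(1) assms(3), of 2] assms dist_2 V by auto
  then have "E u x" using dist_1 V by auto
  then show ?thesis using that x E_sym by blast
qed

lemma common_far2:
  assumes "far2 E u v" "E u x" "E x v" "E u y" "E y v" "x \<noteq> y"
  shows "far2 E x y"
  using no_K4_minus[of u x y v] assms E_sym unfolding far2_def by blast

text \<open>Hence the neighbours of \<open>u\<close> split into cliques, one for each line through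
  \<open>u\<close>.\<close>

lemma nbr_trans:
  assumes "E u a" "E u b" "E u c" "E a b" "E b c" "a \<noteq> c"
  shows "E a c"
  using no_K4_minus[of a u b c] assms E_sym by blast

section \<open>Lines through a vertex\<close>

text \<open>For \<open>x\<close> at distance 2 from \<open>u\<close>, these are the points other
  than \<open>u\<close> of all lines through \<open>u\<close> that contain a common neighbour of
  \<open>u\<close> and \<open>x\<close>. The bound 2 admits whole lines, not just their points next
  to \<open>x\<close>.\<close>

definition dir :: "'a \<Rightarrow> 'a \<Rightarrow> 'a set" where
  "dir u x = {e. E u e \<and> d x e \<le> 2}"

lemma le2_cases: 
  assumes "x \<in> V" "y \<in> V" shows "d x y \<le> 2 \<longleftrightarrow> x = y \<or> E x y \<or> far2 E x y"
proof -
  have "d x y \<le> 2 \<longleftrightarrow> d x y = 0 \<or> d x y = 1 \<or> d x y = 2" by auto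
  then show ?thesis using dist_0 dist_1 dist_2 assms by simp
qed

lemma le2_path: "E x y \<Longrightarrow> E y z \<Longrightarrow> d x z \<le> 2"
  using dist_step[of x y z] dist_edge E_V by simp

lemma dir_obtain:
  assumes "far2 E u x" "e \<in> dir u x"
  obtains c where "E u c" "E c x" "e = c \<or> E e c"
proof -
  have e: "E u e" "d x e \<le> 2" using assms by (auto simp: dir_def)
  have "x \<in> V" "e \<in> V" using far2_V assms e E_V by blast+
  then consider "x = e" | "E x e" | "far2 E x e" using le2_cases e by blast
  then show ?thesis
  proof cases
    case 1
    then show ?thesis using assms e by (simp add: far2_def)
  next
    case 2
    then show ?thesis using that e E_sym by blast
  next
    case 3
    then obtain c where "E c x" "E c u" "E c e" using triangle[OF far2_sym[OF assms(1)] 3 e(1)] by blast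
    then show ?thesis using that E_sym by blast
  qed
qed

lemma dir_near: "E u c \<Longrightarrow> E c x \<Longrightarrow> c \<in> dir u x"
  using dist_edge[of x c] E_sym by (auto simp: dir_def)

lemma dir_closed:
  assumes "far2 E u x" "a \<in> dir u x" "E u e" "E a e"
  shows "e \<in> dir u x"
proof -
  obtain c where c: "E u c" "E c x" "a = c \<or> E a c" using dir_obtain assms by blast
  have "e = c \<or> E e c"
    using c assms nbr_trans[of u e a c] E_sym unfolding dir_def by blast
  then have "d x e \<le> 2" using le2_path[of x c e] dist_edge[of x e] c E_sym by fastforce
  then show ?thesis using assms by (simp add: dir_def)
qed

lemma dir_adjacent:
  assumes "far2 E u x" "far2 E u f" "E x f"
  shows "dir u x = dir u f"
proof -
  have "dir u f \<subseteq> dir u x" if h: "far2 E u x" "far2 E u f" "E x f" for x f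
  proof
    fix e assume e: "e \<in> dir u f"
    then obtain c where c: "E u c" "E c f" "e = c \<or> E e c" using dir_obtain h by blast
    have "c \<in> dir u x" using c le2_path[of x f c] h E_sym by (auto simp: dir_def)
    then show "e \<in> dir u x" using dir_closed[OF h(1)] c e E_sym by (auto simp: dir_def)
  qed
  then show ?thesis using assms E_sym by blast
qed

text \<open>Let \<open>e\<close> be a further common neighbour of \<open>u\<close> and
  \<open>v\<close>. Between \<open>e\<close>, \<open>a\<close>, \<open>c\<close> and
  \<open>u\<close>, \<open>v\<close>, \<open>x\<close> at most the edge \<open>e x\<close> is
  missing, and the forbidden \<open>K_{3,3}^-\<close> keeps \<open>e\<close> within distance 2 of
  \<open>x\<close>.\<close>

lemma dir_share_two:
  assumes "far2 E u v" "far2 E u x" "far2 E a c" "E u a" "E u c" "E a v" "E c v" "E a x" "E c x"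
  shows "dir u v = dir u x"
proof -
  have "dir u v \<subseteq> dir u x" if h: "far2 E u v" "far2 E u x" "E a v" "E c v" "E a x" "E c x" "v \<noteq> x" for v x
  proof
    fix e0 assume e0: "e0 \<in> dir u v"
    then obtain e where e: "E u e" "E e v" "e0 = e \<or> E e0 e" using dir_obtain h by blast
    have "e \<in> dir u x"
    proof (cases "e = a \<or> e = c")
      case True
      then show ?thesis using dir_near assms h by blast
    next
      case False
      have vx: "far2 E v x" using common_far2[OF assms(3) h(3)] h E_sym by blast
      have f: "far2 E e a" "far2 E e c"
        using common_far2[OF h(1) e(1,2)] assms h False by blast+
      have "\<not> beyond2 E e x"
      proof
        assume "beyond2 E e x"
        from no_K33_minus[OF _ _ _ _ _ _ _ _ this, of u v a c] show False
          using e f assms h vx E_sym far2_sym by blast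
      qed
      then have "d x e \<le> 2"
        using dist_ge_3[of e x] dist_sym[of e x] far2_V[OF h(2)] E_V[OF e(1)] by simp
      then show ?thesis using e by (simp add: dir_def)
    qed
    then show "e0 \<in> dir u x" using dir_closed[OF h(2)] e e0 E_sym by (auto simp: dir_def)
  qed
  then show ?thesis using assms by (cases "v = x") blast+
qed

text \<open>One shared neighbour may slide along its line from \<open>a\<close> to
  \<open>a'\<close>. The triangle condition at \<open>a\<close> over \<open>c x\<close> gives a
  neighbour \<open>f\<close> of \<open>x\<close> that is adjacent to \<open>a\<close> and
  \<open>c\<close>, and \<open>f\<close> mediates between \<open>v\<close> and
  \<open>x\<close>.\<close>

lemma dir_share_near:
  assumes "far2 E u v" "far2 E u x" "far2 E a c" "E u a" "E u c" "E u a'" "E a v" "E c v" "E a' x" "E c x"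
    and "a = a' \<or> E a a'"
  shows "dir u v = dir u x"
proof (cases "a = a'")
  case True
  then show ?thesis using dir_share_two[of u v x a c] assms by blast
next
  case False
  then have aa: "E a a'" using assms by blast
  have "\<not> E a x" using common_far2[OF assms(2,4) _ assms(6,9) False] aa unfolding far2_def by blast
  moreover have "a \<noteq> x" using assms(2,4) by (auto simp: far2_def)
  ultimately have "far2 E a x" using aa assms(9) by (auto simp: far2_def)
  then obtain f where f: "E f a" "E f c" "E f x" using triangle[OF assms(3) _ assms(10)] by blast
  have uf: "far2 E u f"
    using common_far2[OF assms(3), of u f] f assms E_sym unfolding far2_def by blast
  have "dir u v = dir u f"
    using dir_share_two[OF assms(1) uf assms(3,4,5,7,8)] f E_sym by blast
  also have "\<dots> = dir u x" using dir_adjacent[OF uf assms(2) f(3)] .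
  finally show ?thesis .
qed

text \<open>Two lines through \<open>u\<close> fix all directions. The points of these lines next to
  \<open>v\<close> and next to \<open>x\<close> may differ on both lines; thickness provides a
  further common neighbour \<open>f\<close> of \<open>a1\<close> and \<open>c2\<close>, so that in
  passing from \<open>v\<close> to \<open>f\<close> and from \<open>f\<close> to \<open>x\<close>
  only one point slides at a time.\<close>

lemma dir_share:
  assumes "far2 E u v" "far2 E u x" "far2 E a c" "a \<in> dir u v" "c \<in> dir u v" "a \<in> dir u x" "c \<in> dir u x"
  shows "dir u v = dir u x"
proof -
  have Eu: "E u a" "E u c" using assms by (auto simp: dir_def)
  obtain a1 where a1: "E u a1" "E a1 v" "a = a1 \<or> E a a1" using dir_obtain assms by blast
  obtain c1 where c1: "E u c1" "E c1 v" "c = c1 \<or> E c c1" using dir_obtain assms by blast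
  obtain a2 where a2: "E u a2" "E a2 x" "a = a2 \<or> E a a2" using dir_obtain assms by blast
  obtain c2 where c2: "E u c2" "E c2 x" "c = c2 \<or> E c c2" using dir_obtain assms by blast
  have par: "p = r \<or> E p r" if "p = q \<or> E p q" "q = r \<or> E q r" "E u p" "E u q" "E u r" for p q r
    using nbr_trans that by blast
  have a12: "a1 = a2 \<or> E a1 a2" using par[of a1 a a2] a1 a2 Eu E_sym by blast
  have c12: "c1 = c2 \<or> E c1 c2" using par[of c1 c c2] c1 c2 Eu E_sym by blast
  have far: "far2 E a' c'" if "a = a' \<or> E a a'" "c = c' \<or> E c c'" "E u a'" "E u c'" for a' c'
  proof -
    have "\<not> (a' = c' \<or> E a' c')"
    proof
      assume "a' = c' \<or> E a' c'"
      then have "a = c' \<or> E a c'" using par[of a a' c'] that Eu by blast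
      then have "a = c \<or> E a c" using par[of a c' c] that Eu E_sym by blast
      then show False using assms(3) by (auto simp: far2_def)
    qed
    then show ?thesis using that E_sym unfolding far2_def by blast
  qed
  have f: "far2 E a1 c1" "far2 E a1 c2" "far2 E a2 c2" using far a1 a2 c1 c2 by blast+
  obtain f where fu: "f \<noteq> u" "E a1 f" "E f c2"
    using thick[OF f(2)] unfolding far2_def by metis
  have uf: "far2 E u f"
    using common_far2[OF f(2), of u f] fu a1 c2 E_sym by blast
  have "dir u v = dir u f"
    by (rule dir_share_near[OF assms(1) uf far2_sym[OF f(1)], of c2]) (use a1 c1 c2 c12 fu E_sym in blast)+
  also have "\<dots> = dir u x"
    by (rule dir_share_near[OF uf assms(2) f(2), of a2]) (use a1 a2 c2 a12 fu E_sym in blast)+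
  finally show ?thesis .
qed

section \<open>Quads: closure, diameter and gates\<close>

definition quad :: "'a \<Rightarrow> 'a \<Rightarrow> 'a set" where
  "quad u v = {u} \<union> dir u v \<union> {x. far2 E u x \<and> dir u x = dir u v}"

context
  fixes u v
  assumes uv: "far2 E u v"
begin

lemma quad_cases:
  assumes "x \<in> quad u v"
  obtains "x = u" | "x \<in> dir u v" "E u x" | "far2 E u x" "dir u x = dir u v"
  using assms unfolding quad_def dir_def by blast

lemma quad_V: "quad u v \<subseteq> V"
  using far2_V uv E_V unfolding quad_def dir_def by blast

lemma quad_base: "u \<in> quad u v" "v \<in> quad u v"
  using uv by (auto simp: quad_def)

lemma dir_two:
  obtains a c where "a \<in> dir u v" "c \<in> dir u v" "far2 E a c"
  using thick[OF uv] dir_near that by blast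

text \<open>By symmetry \<open>x\<close> is no farther from \<open>u\<close> than \<open>y\<close>.
  The hard case has \<open>z\<close> beyond distance 2 from \<open>u\<close>: the quadrangle
  condition gives a common neighbour \<open>w\<close> of \<open>u\<close>, \<open>x\<close>,
  \<open>y\<close>, a line of the quad avoiding \<open>w\<close> gives another one, and together
  with \<open>z\<close> these form a forbidden \<open>K_{3,3}^-\<close>.\<close>

lemma quad_closed:
  assumes xy: "x \<in> quad u v" "y \<in> quad u v" "x \<noteq> y" and z: "E z x" "E z y"
  shows "z \<in> quad u v"
proof -
  have main: "z \<in> quad u v" if "x \<in> quad u v" "y \<in> quad u v" "x \<noteq> y" "E z x" "E z y"
    and d: "y = u \<longrightarrow> x = u" "y \<in> dir u v \<longrightarrow> x = u \<or> x \<in> dir u v" for x y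
  proof -
    note z = that(4,5)
    have V: "u \<in> V" "x \<in> V" "y \<in> V" "z \<in> V" using quad_V that E_V uv far2_V by blast+
    have dirI: "z \<in> quad u v" if "z \<in> dir u v" using that by (simp add: quad_def)
    have farI: "z \<in> quad u v" if "far2 E u z" "dir u z = dir u v" using that by (simp add: quad_def)
    from that(1) show ?thesis
    proof (cases rule: quad_cases)
      case 1
      then have Euz: "E u z" using z E_sym by blast
      from that(2) show ?thesis
      proof (cases rule: quad_cases)
        case y: 1
        then show ?thesis using 1 that by simp
      next
        case 2
        then show ?thesis using dirI dir_closed[OF uv] Euz z E_sym by blast
      next
        case 3
        then show ?thesis using dirI dir_near[OF Euz z(2)] by simp
      qed
    next
      case 2
      have "d u z \<le> 2" using le2_path 2 z E_sym by blast
      then consider "z = u" | "E u z" | "far2 E u z" using le2_cases V by blast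
      then show ?thesis
      proof cases
        case 1
        then show ?thesis using quad_base by simp
      next
        case b: 2
        then show ?thesis using dirI dir_closed[OF uv 2(1) b] z E_sym by blast
      next
        case f: 3
        from that(2) show ?thesis
        proof (cases rule: quad_cases)
          case 1
          then show ?thesis using d 2 E_irrefl by blast
        next
          case y: 2
          have "\<not> E x y" using no_K4_minus[of u x y z] 2 y f z E_sym unfolding far2_def by blast
          then have "far2 E x y" using that 2 y E_sym unfolding far2_def by blast
          from dir_share[OF f uv this] have "dir u z = dir u v"
            using 2 y dir_near z E_sym by blast
          then show ?thesis using farI f by blast
        next
          case 3
          then show ?thesis using farI f dir_adjacent[OF f 3(1) z(2)] by blast
        qed
      qed
    next
      case x: 3
      have y: "far2 E u y" "dir u y = dir u v"
        using that(2) x d E_irrefl unfolding quad_def dir_def far2_def by blast+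
      consider "z = u" | "E u z" | "far2 E u z" | "beyond2 E u z"
        unfolding far2_def beyond2_def by blast
      then show ?thesis
      proof cases
        case 1
        then show ?thesis using quad_base by simp
      next
        case 2
        then show ?thesis using dirI dir_near[OF 2 z(1)] x by simp
      next
        case 3
        then show ?thesis using farI dir_adjacent[OF 3 x(1) z(1)] x by blast
      next
        case 4
        have d2: "d u x = 2" "d u y = 2" using dist_2 V x y by blast+
        have "d u z = 3"
          using 4 dist_ge_3[OF V(1,4)] dist_step[OF V(1) E_sym[OF z(1)]] d2 by simp
        then obtain w where w: "E w x" "E w y" "Suc (d u w) = 2" "w \<in> V"
          using QC_obtain[OF V(1) z, of 2] d2 by auto
        then have uw: "E u w" using dist_1 V by auto
        have nz: "z \<noteq> w'" "\<not> E z w'" if "E u w'" for w'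
          using 4 that E_sym unfolding beyond2_def by blast+
        have xy: "far2 E x y"
          using no_K4_minus[of z x y w] nz[OF uw] w z that(3) E_sym unfolding far2_def by blast
        have far_z: "far2 E z w'" if "E u w'" "E w' x \<or> E w' y" for w'
          using nz[OF that(1)] that(2) z E_sym unfolding far2_def by blast
        obtain a c where ac: "a \<in> dir u v" "c \<in> dir u v" "far2 E a c" using dir_two by blast
        have Euac: "E u a" "E u c" using ac by (auto simp: dir_def)
        have "\<exists>e \<in> dir u v. \<not> (w = e \<or> E w e)"
        proof (rule ccontr)
          assume "\<not> ?thesis"
          then have "w = a \<or> E w a" "w = c \<or> E w c" using ac by blast+
          then have "a = c \<or> E a c" using nbr_trans[of u a w c] Euac uw E_sym by blast
          then show False using ac by (auto simp: far2_def)
        qed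
        then obtain e where e: "e \<in> dir u v" "\<not> (w = e \<or> E w e)" by blast
        have Eue: "E u e" using e by (simp add: dir_def)
        obtain a2 where a2: "E u a2" "E a2 x" "e = a2 \<or> E e a2" using dir_obtain[OF x(1)] x(2) e by blast
        obtain b2 where b2: "E u b2" "E b2 y" "e = b2 \<or> E e b2" using dir_obtain[OF y(1)] y(2) e by blast
        \<comment> \<open>Otherwise \<open>a2\<close> and \<open>b2\<close> are adjacent, and the
          triangle condition at \<open>z\<close> gives a common neighbour \<open>s\<close> of
          \<open>z\<close>, \<open>a2\<close>, \<open>b2\<close>. Absence of \<open>K_4^-\<close>
          makes \<open>s\<close> adjacent to \<open>u\<close>, too close to
          \<open>z\<close>.\<close>
        have "a2 = b2"
        proof (rule ccontr)
          assume ne: "a2 \<noteq> b2"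
          then have Eab: "E a2 b2" using nbr_trans[of u a2 e b2] a2 b2 Eue E_sym by blast
          obtain s where s: "E s z" "E s a2" "E s b2"
            using triangle[OF far_z[OF a2(1)] far_z[OF b2(1)] Eab] a2 b2 by blast
          have "E s u"
            using no_K4_minus[of s a2 b2 u] s a2 b2 Eab nz[OF a2(1)] 4 E_sym unfolding beyond2_def by blast
          then show False using 4 s E_sym unfolding beyond2_def by blast
        qed
        then have a2y: "E a2 y" using b2 by simp
        have "\<not> (w = a2 \<or> E w a2)" using nbr_trans[of u w a2 e] e a2 uw Eue E_sym by blast
        then have wa2: "far2 E w a2" using uw a2 E_sym unfolding far2_def by blast
        have "beyond2 E z u" using 4 E_sym unfolding beyond2_def by blast
        from no_K33_minus[OF z(1,2) _ w(1,2) _ a2(2) a2y this far_z[OF uw] far_z[OF a2(1)] wa2 x(1) y(1) xy]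
        show ?thesis using uw a2 w E_sym by blast
      qed
    qed
  qed
  show ?thesis
  proof (cases "(y = u \<longrightarrow> x = u) \<and> (y \<in> dir u v \<longrightarrow> x = u \<or> x \<in> dir u v)")
    case True
    then show ?thesis using main assms by blast
  next
    case False
    have "u \<notin> dir u v" using E_irrefl by (simp add: dir_def)
    then show ?thesis using main[OF xy(2,1)] xy(3) z False by blast
  qed
qed

text \<open>The critical case has \<open>x\<close> and \<open>y\<close> both at distance 2 from
  \<open>u\<close>. If they were farther than 2 apart, equal directions would put the common
  neighbours of \<open>u\<close> and \<open>x\<close> at distance 2 from \<open>y\<close>. The
  quadrangle condition from \<open>y\<close> and the triangle condition from \<open>u\<close> then
  give a triangle \<open>m\<close>, \<open>z\<close>, \<open>y\<close>; the triangle condition from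
  \<open>x\<close> gives a neighbour \<open>g\<close> of \<open>x\<close>, \<open>m\<close> and
  \<open>z\<close>, which must be adjacent to \<open>y\<close>.\<close>

lemma quad_diameter:
  assumes "x \<in> quad u v" "y \<in> quad u v"
  shows "d x y \<le> 2"
proof -
  have V: "u \<in> V" "x \<in> V" "y \<in> V" using quad_V assms uv far2_V by blast+
  have near: "d u z \<le> 2" if "z \<in> quad u v" for z
    using that 
  proof (cases rule: quad_cases)
    case 3
    then show ?thesis using dist_2[of u z] far2_V[OF 3(1)] by simp
  qed (use V dist_edge in auto)
  have dd: "d x y \<le> 2" if "x \<in> dir u v" "y \<in> quad u v" for x y
    using that(2)
  proof (cases rule: quad_cases)
    case 1
    then show ?thesis using that dist_edge[of x u] E_sym[of u x] by (auto simp: dir_def)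
  next
    case 2
    then show ?thesis using that le2_path[of x u y] E_sym by (auto simp: dir_def)
  next
    case 3
    then have "x \<in> dir u y" using that by simp
    then show ?thesis using dist_sym[of x y] E_V[of u x] far2_V[OF 3(1)] by (auto simp: dir_def)
  qed
  from assms(1) show ?thesis
  proof (cases rule: quad_cases)
    case 1
    then show ?thesis using near assms by simp
  next
    case 2
    then show ?thesis using dd assms by blast
  next
    case x: 3
    from assms(2) show ?thesis
    proof (cases rule: quad_cases)
      case 1
      then show ?thesis using near[OF assms(1)] dist_sym V by simp
    next
      case 2
      then show ?thesis using dd[OF 2(1) assms(1)] dist_sym[OF V(2,3)] by simp
    next
      case y: 3
      show ?thesis
      proof (rule ccontr)
        assume far: "\<not> d x y \<le> 2"
        have near_y: "d y a = 2 \<and> d y x = 3" if a: "E u a" "E a x" for a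
        proof -
          have "a \<in> dir u y" using dir_near[OF a] x y by simp
          then have "d y a \<le> 2" by (simp add: dir_def)
          moreover have "d y x \<le> Suc (d y a)" using dist_step[OF V(3) a(2)] .
          ultimately show ?thesis using far dist_sym V by simp
        qed
        obtain a c where ac: "E u a" "E a x" "E u c" "E c x" "far2 E a c"
          using thick[OF x(1)] by blast
        have ac_quad: "a \<in> quad u v" "c \<in> quad u v"
          using dir_near[OF ac(1,2)] dir_near[OF ac(3,4)] x by (auto simp: quad_def)
        have dy: "d y a = 2" "d y c = 2" "d y x = 3" using near_y ac by blast+
        obtain z where z: "E z a" "E z c" "Suc (d y z) = 2" "z \<in> V"
          using QC_obtain[OF V(3) E_sym[OF ac(2)] E_sym[OF ac(4)], of 2] dy by auto
        then have yz: "E y z" using dist_1 V by auto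
        have uz: "far2 E u z"
          using common_far2[OF ac(5), of u z] ac z yz y(1) E_sym unfolding far2_def by blast
        obtain m where m: "E m u" "E m z" "E m y"
          using triangle[OF uz y(1) E_sym[OF yz]] by blast
        have "m \<in> dir u x" using dir_near[OF E_sym[OF m(1)] m(3)] x y by simp
        then have "d x m \<le> 2" by (simp add: dir_def)
        moreover have "d x z \<le> 2" using le2_path ac z E_sym by blast
        moreover have "d x y = 3" using dy dist_sym V by simp
        ultimately have xm: "d x m = 2" "d x z = 2"
          using dist_step[OF V(2) m(3)] dist_step[OF V(2) E_sym[OF yz]] by simp_all
        obtain g where g: "E g m" "E g z" "Suc (d x g) = 2" "g \<in> V"
          using TC_obtain[OF V(2) m(2) xm] by auto
        have "g \<noteq> y" using g \<open>d x y = 3\<close> by auto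
        then have "E g y" using no_K4_minus[of g m z y] g m yz E_sym by blast
        then have "d x y \<le> 2" using dist_step[OF V(2), of g y] g by simp
        then show False using far by simp
      qed
    qed
  qed
qed

text \<open>A nearest vertex \<open>q\<close> is the gate: whenever distances fail to grow away from
  it, a triangle or quadrangle condition yields a vertex that lies in the quad by closure and
  violates minimality or uniqueness. Diameter 2 limits the check to two steps from
  \<open>q\<close>.\<close>

lemma quad_gated: "gated V E (quad u v)"
  unfolding gated_def
proof (intro conjI ballI)
  show "quad u v \<subseteq> V" by (rule quad_V)
  fix w assume w: "w \<in> V"
  obtain q where q: "q \<in> quad u v" and min: "\<And>y. y \<in> quad u v \<Longrightarrow> d w q \<le> d w y"
    using ex_has_least_nat[of "\<lambda>q. q \<in> quad u v" u "d w"] quad_base by blast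
  define k where "k = d w q"
  \<comment> \<open>Settles \<open>w\<close> inside the quad, where the triangle and quadrangle
    conditions, which need positive distance, say nothing.\<close>
  have zero: "y = q" if "d w y = k" "k = 0" "y \<in> V" for y
    using that dist_0 w quad_V q unfolding k_def by (metis subsetD)
  have adj: "d w y = Suc k" if y: "y \<in> quad u v" "E q' y" "q' \<in> quad u v" "d w q' = k" for y q'
  proof (rule ccontr)
    assume "d w y \<noteq> Suc k"
    then have eq: "d w y = k"
      using min[OF y(1)] dist_step[OF w y(2)] y(4) unfolding k_def by simp
    have "k > 0" using zero[OF eq] zero[OF y(4)] E_V[OF y(2)] E_neq[OF y(2)] by auto
    then obtain z where z: "E z q'" "E z y" "Suc (d w z) = k" using TC_obtain[OF w y(2) y(4) eq] by blast
    then have "z \<in> quad u v" using quad_closed[OF y(3,1) E_neq[OF y(2)]] by blast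
    then show False using min z unfolding k_def by fastforce
  qed
  have two: "y = y'" if y: "y \<in> quad u v" "y' \<in> quad u v" "E t y" "E t y'" "t \<in> quad u v" "d w y = k" "d w y' = k" for y y' t
  proof (rule ccontr)
    assume ne: "y \<noteq> y'"
    have "k > 0" using zero[OF y(6)] zero[OF y(7)] ne E_V[OF y(3)] E_V[OF y(4)] by auto
    moreover have "d w t = Suc k" using adj[OF y(5) E_sym[OF y(3)] y(1,6)] .
    ultimately obtain z where z: "E z y" "E z y'" "Suc (d w z) = k"
      using QC_obtain[OF w y(3,4) _ y(6,7)] by blast
    then have "z \<in> quad u v" using quad_closed[OF y(1,2) ne] by blast
    then show False using min z unfolding k_def by fastforce
  qed
  show "\<exists>q\<in>quad u v. \<forall>y\<in>quad u v. q \<in> interval V E w y"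
  proof (intro bexI[OF _ q] ballI)
    fix y assume y: "y \<in> quad u v"
    have V: "q \<in> V" "y \<in> V" using q y quad_V by blast+
    have "d w q + d q y = d w y"
    proof -
      consider "q = y" | "E q y" | "far2 E q y"
        using quad_diameter[OF q y] le2_cases V by blast
      then show ?thesis
      proof cases
        case 1
        then show ?thesis using V by simp
      next
        case 2
        then show ?thesis using adj[OF y 2 q] dist_edge[OF 2] unfolding k_def by simp
      next
        case 3
        then obtain t where t: "E q t" "E t y" "q \<noteq> y" unfolding far2_def by blast
        have tq: "t \<in> quad u v" using quad_closed[OF q y t(3)] t E_sym by blast
        have dt: "d w t = Suc k" using adj[OF tq t(1) q] unfolding k_def by simp
        have "d w y \<noteq> k"
          using two[OF q y E_sym[OF t(1)] t(2) tq] t(3) unfolding k_def by blast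
        \<comment> \<open>The triangle condition over \<open>t y\<close> would give a nearest vertex
          adjacent to \<open>t\<close> and \<open>y\<close>; by \<open>two\<close> it is
          \<open>q\<close>, which is not adjacent to \<open>y\<close>.\<close>
        moreover have "d w y \<noteq> Suc k"
        proof
          assume dy: "d w y = Suc k"
          obtain z where z: "E z t" "E z y" "Suc (d w z) = Suc k"
            using TC_obtain[OF w t(2) dt dy] by blast
          have "z \<in> quad u v" using quad_closed[OF tq y E_neq[OF t(2)]] z by blast
          then have "q = z"
            using two[OF q _ E_sym[OF t(1)] E_sym[OF z(1)] tq] z unfolding k_def by simp
          then show False using z 3 unfolding far2_def by blast
        qed
        moreover have "d w y \<le> Suc (d w t)" using dist_step[OF w t(2)] .
        moreover have "k \<le> d w y" using min[OF y] unfolding k_def .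
        ultimately have "d w y = Suc (Suc k)" using dt by simp
        then show ?thesis using dist_2 V 3 unfolding k_def by simp
      qed
    qed
    then show "q \<in> interval V E w y" using V unfolding interval_def by simp
  qed
qed

end

section \<open>Gated cliques, opposite neighbours and finiteness\<close>

text \<open>If two vertices of \<open>K\<close> were equally near to \<open>w\<close>, the triangle
  condition would give a nearer common neighbour. Absence of \<open>K_4^-\<close> makes it adjacent
  to all of \<open>K\<close>, against maximality.\<close>

lemma maximal_clique_gated:
  assumes K: "maximal_clique V E K"
  shows "gated V E K"
  unfolding gated_def
proof (intro conjI ballI)
  have c: "K \<subseteq> V" "\<And>x y. x \<in> K \<Longrightarrow> y \<in> K \<Longrightarrow> x \<noteq> y \<Longrightarrow> E x y"
    and max: "\<And>K'. clique V E K' \<Longrightarrow> K \<subseteq> K' \<Longrightarrow> K' = K"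
    using K unfolding maximal_clique_def clique_def by blast+
  show "K \<subseteq> V" by fact
  obtain v where "v \<in> V" using conn unfolding connected_graph_def by blast
  then have "K \<noteq> {}" using max[of "{v}"] by (auto simp: clique_def)
  then obtain q0 where q0: "q0 \<in> K" by blast
  fix w assume w: "w \<in> V"
  obtain q where q: "q \<in> K" and min: "\<And>y. y \<in> K \<Longrightarrow> d w q \<le> d w y"
    using ex_has_least_nat[of "\<lambda>q. q \<in> K" q0 "d w"] q0 by blast
  show "\<exists>q\<in>K. \<forall>y\<in>K. q \<in> interval V E w y"
  proof (intro bexI[OF _ q] ballI)
    fix y assume y: "y \<in> K"
    have V: "q \<in> V" "y \<in> V" using q y c by blast+
    have "d w q + d q y = d w y"
    proof (cases "q = y")
      case False
      then have E: "E q y" using c q y by blast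
      have "d w y \<noteq> d w q"
      proof
        assume eq: "d w y = d w q"
        have "d w q > 0" using dist_0[OF w V(1)] dist_0[OF w V(2)] eq False by auto
        then obtain z where z: "E z q" "E z y" "Suc (d w z) = d w q" "z \<in> V"
          using TC_obtain[OF w E refl eq] by blast
        have zK: "z \<notin> K" using min z(3) by fastforce
        have "E z t" if "t \<in> K" for t
          using no_K4_minus[of z q y t] z c(2) that q y E zK E_sym by metis
        then have "clique V E (insert z K)" using c z E_sym unfolding clique_def by blast
        then show False using max zK by blast
      qed
      then show ?thesis using min[OF y] dist_step[OF w E] dist_edge[OF E] by simp
    qed (use V in simp)
    then show "q \<in> interval V E w y" using V unfolding interval_def by simp
  qed
qed

text \<open>Induction moves \<open>v\<close> one step towards \<open>x\<close>, to
  \<open>v'\<close>, where an opposite neighbour \<open>y'\<close> is known. In the quad of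
  \<open>y'\<close> and \<open>v\<close> the gate of \<open>u\<close> is \<open>y'\<close> and that
  of \<open>x\<close> is \<open>v'\<close>; a second common neighbour \<open>y\<close> of
  \<open>y'\<close> and \<open>v\<close> is therefore one step past the gate of \<open>u\<close> and
  two steps past the gate of \<open>x\<close>.\<close>

lemma opposite:
  assumes "d u v = Suc n" "E u x" "d x v = n" "v \<in> V"
  shows "\<exists>y. E v y \<and> d u y = n \<and> d x y = Suc n"
  using assms
proof (induction n arbitrary: v)
  case 0
  then have "x = v" using dist_0 E_V by blast
  then show ?case using 0 dist_edge[of x u] E_sym E_V by force
next
  case (Suc n)
  have V: "u \<in> V" "x \<in> V" "v \<in> V" using Suc.prems E_V by blast+
  obtain v' where v': "E v' v" "d x v' = n" "v' \<in> V" using dist_Suc[OF V(2,3) Suc.prems(3)] by blast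
  have "d u v' = Suc n"
    using dist_step[OF V(1) v'(1)] dist_triangle[OF V(1,2) v'(3)] dist_edge[OF Suc.prems(2)] Suc.prems(1) v'(2)
    by simp
  then obtain y' where y': "E v' y'" "d u y' = n" "d x y' = Suc n"
    using Suc.IH[of v'] Suc.prems v' by blast
  have Vy': "y' \<in> V" using E_V y' by blast
  have "d y' v \<le> 2" using le2_path y' v' E_sym by blast
  moreover have "Suc (Suc n) \<le> n + d y' v"
    using dist_triangle[OF V(1) Vy' V(3)] Suc.prems(1) y'(2) by simp
  ultimately have far: "far2 E y' v" using dist_2 Vy' V by simp
  obtain y where y: "y \<noteq> v'" "E y' y" "E y v"
    using thick[OF far] unfolding far2_def by metis
  have vy: "far2 E v' y" using common_far2[OF far] y y' v' E_sym by blast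
  let ?Q = "quad y' v"
  have Q: "y' \<in> ?Q" "v \<in> ?Q" using quad_base[OF far] .
  have ne: "y' \<noteq> v" using far by (simp add: far2_def)
  have Q': "v' \<in> ?Q" "y \<in> ?Q"
    using quad_closed[OF far Q ne] y y' v' E_sym by blast+
  obtain g where g: "g \<in> ?Q" "\<And>z. z \<in> ?Q \<Longrightarrow> d u g + d g z = d u z"
    using quad_gated[OF far] V unfolding gated_def interval_def by blast
  obtain h where h: "h \<in> ?Q" "\<And>z. z \<in> ?Q \<Longrightarrow> d x h + d h z = d x z"
    using quad_gated[OF far] V unfolding gated_def interval_def by blast
  have Vgh: "g \<in> V" "h \<in> V" "y \<in> V" using g h Q' quad_V[OF far] by blast+
  \<comment> \<open>\<open>v\<close> is within 2 of the gate but at distance \<open>n + 2\<close>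
    from \<open>u\<close>, so the gate is no nearer to \<open>u\<close> than
    \<open>y'\<close>.\<close>
  have "d g y' = 0"
    using g(2)[OF Q(1)] g(2)[OF Q(2)] quad_diameter[OF far g(1) Q(2)] Suc.prems(1) y'(2) by simp
  then have gy: "g = y'" using dist_0 Vgh Vy' by blast
  \<comment> \<open>Another gate would be nearer to \<open>x\<close> than \<open>v'\<close>, hence
    within \<open>n\<close> of \<open>u\<close>, which leaves only \<open>y'\<close>; but
    \<open>y'\<close> is farther from \<open>x\<close>.\<close>
  have hv: "h = v'"
  proof (rule ccontr)
    assume "h \<noteq> v'"
    then have "d h v' \<noteq> 0" using dist_0 Vgh v' by blast
    then have "Suc (d x h) \<le> n" using h(2)[OF Q'(1)] v'(2) by simp
    moreover have "d u h \<le> Suc (d x h)"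
      using dist_triangle[OF V(1,2) Vgh(2)] dist_edge[OF Suc.prems(2)] by simp
    moreover have "n + d y' h = d u h" using g(2)[OF h(1)] gy y'(2) by simp
    ultimately have "d y' h = 0" by simp
    then have "h = y'" using dist_0 Vgh Vy' by blast
    then show False using \<open>Suc (d x h) \<le> n\<close> y'(3) by simp
  qed
  have "d x y = Suc (Suc n)"
    using h(2)[OF Q'(2)] hv v' dist_2[of v' y] vy Vgh by simp
  moreover have "d u y = Suc n"
    using g(2)[OF Q'(2)] gy y' dist_edge[OF y(2)] by simp
  ultimately show ?case using y E_sym by blast
qed

theorem dual_polar: "dual_polar V E"
  unfolding dual_polar_def
proof (intro conjI ballI allI impI)
  show "connected_graph V E" by (rule conn)
  show "gated V E K" if "maximal_clique V E K" for K
    using maximal_clique_gated that .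
next
  fix u v assume V: "u \<in> V" "v \<in> V" and d: "d u v = 2"
  have far: "far2 E u v" using d dist_2 V by blast
  let ?H = "gated_hull V E {u, v}"
  have "?H \<subseteq> quad u v"
    using quad_gated[OF far] quad_base[OF far] unfolding gated_hull_def by blast
  then have "\<forall>x\<in>?H. \<forall>y\<in>?H. d x y \<le> 2" using quad_diameter[OF far] by blast
  moreover have "u \<in> ?H" "v \<in> ?H" unfolding gated_hull_def by blast+
  ultimately show "let H = ?H in (\<forall>x\<in>H. \<forall>y\<in>H. d x y \<le> 2) \<and> (\<exists>x\<in>H. \<exists>y\<in>H. d x y = 2)"
    using d unfolding Let_def by blast
next
  fix u v x
  assume V: "u \<in> V" "v \<in> V" "x \<in> V" and a: "u \<noteq> v \<and> \<not> E u v \<and> E u x \<and> x \<in> I u v"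
  then have x: "Suc (d x v) = d u v" using dist_edge[of u x] unfolding interval_def by simp
  then obtain y where y: "E v y" "d u y = d x v" "d x y = Suc (d x v)"
    using opposite[of u v "d x v" x] a V by auto
  then show "\<exists>y\<in>V. E v y \<and> y \<in> I u v \<and> d u v = d x y \<and> d x y = d u y + 1 \<and> d u y + 1 = d x v + 1"
    using x dist_edge[OF E_sym[OF y(1)]] E_V[OF y(1)] unfolding interval_def by auto
qed

text \<open>Going from \<open>v'\<close> to \<open>v\<close>, one step farther from
  \<open>u\<close>, keeps every counted neighbour of \<open>u\<close> and adds one:
  \<open>opposite\<close>, read from \<open>v\<close> with first step \<open>v'\<close>, gives a
  neighbour of \<open>u\<close> nearer to \<open>v\<close> but not to \<open>v'\<close>.\<close>

lemma dist_le_degree: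
  assumes "u \<in> V" "v \<in> V" "finite {x. E u x}"
  shows "d u v \<le> card {x. E u x \<and> Suc (d x v) = d u v}"
  using assms(2)
proof (induction "d u v" arbitrary: v)
  case (Suc n)
  obtain v' where v': "E v' v" "d u v' = n" "v' \<in> V"
    using dist_Suc[OF assms(1) Suc.prems] Suc.hyps(2) by metis
  have "d v u = Suc n" "d v' u = n" using dist_sym assms(1) Suc v' by auto
  then obtain y where y: "E u y" "d v y = n" "d v' y = Suc n"
    using opposite[of v u n v'] v' E_sym assms by blast
  let ?S = "\<lambda>v. {x. E u x \<and> Suc (d x v) = d u v}"
  have "?S v' \<subset> ?S v"
  proof
    show "?S v' \<subseteq> ?S v"
    proof clarify
      fix x assume x: "E u x" "Suc (d x v') = d u v'"
      have Vx: "x \<in> V" using E_V x by blast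
      have "d x v \<le> n" using dist_step[OF Vx v'(1)] x v' by simp
      moreover have "Suc n \<le> Suc (d x v)"
        using dist_triangle[OF assms(1) Vx Suc.prems] dist_edge[OF x(1)] Suc.hyps by simp
      ultimately show "Suc (d x v) = d u v" using Suc.hyps by simp
    qed
    have Vy: "y \<in> V" using E_V y by blast
    have "y \<in> ?S v" "y \<notin> ?S v'" using y dist_sym[OF Vy] Suc.prems Suc.hyps v' by auto
    then show "?S v' \<noteq> ?S v" by blast
  qed
  moreover have "finite (?S v)" using assms(3) by (rule rev_finite_subset) blast
  ultimately have "card (?S v') < card (?S v)" by (rule psubset_card_mono[rotated])
  moreover have "n \<le> card (?S v')" using Suc.hyps(1)[of v'] v' by simp
  ultimately show ?case using Suc.hyps(2) by simp
qed simp

theorem finite_if_locally_finite: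
  assumes "locally_finite V E" shows "finite V"
proof -
  obtain u where u: "u \<in> V" using conn unfolding connected_graph_def by blast
  have fin: "finite {x. E v x}" if "v \<in> V" for v using assms that unfolding locally_finite_def by blast
  have ball: "finite {v \<in> V. d u v \<le> n}" for n
  proof (induction n)
    case 0
    have "{v \<in> V. d u v \<le> 0} \<subseteq> {u}" using dist_0 u by auto
    then show ?case using finite_subset by blast
  next
    case (Suc n)
    have "{v \<in> V. d u v \<le> Suc n} \<subseteq> {v \<in> V. d u v \<le> n} \<union> (\<Union>w \<in> {v \<in> V. d u v \<le> n}. {x. E w x})"
    proof
      fix v assume v: "v \<in> {v \<in> V. d u v \<le> Suc n}"
      show "v \<in> {v \<in> V. d u v \<le> n} \<union> (\<Union>w \<in> {v \<in> V. d u v \<le> n}. {x. E w x})"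
      proof (cases "d u v = Suc n")
        case True
        then obtain w where "E w v" "d u w = n" "w \<in> V" using dist_Suc[OF u] v by blast
        then show ?thesis by blast
      qed (use v in auto)
    qed
    moreover have "finite ({v \<in> V. d u v \<le> n} \<union> (\<Union>w \<in> {v \<in> V. d u v \<le> n}. {x. E w x}))"
      using Suc.IH fin by auto
    ultimately show ?case by (rule finite_subset)
  qed
  have "d u v \<le> card {x. E u x}" if "v \<in> V" for v
  proof -
    have "d u v \<le> card {x. E u x \<and> Suc (d x v) = d u v}" using dist_le_degree[OF u that fin[OF u]] .
    also have "\<dots> \<le> card {x. E u x}" by (rule card_mono[OF fin[OF u]]) blast
    finally show ?thesis .
  qed
  then have "V = {v \<in> V. d u v \<le> card {x. E u x}}" by blast
  then show ?thesis using ball[of "card {x. E u x}"] by simp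
qed

end

section \<open>Coverings\<close>

lemma induced_square_flip: "induced_square E x y z w \<Longrightarrow> (\<And>x y. E x y \<Longrightarrow> E y x) \<Longrightarrow> induced_square E x w z y"
  unfolding induced_square_def by auto

section \<open>Calculus of homotopies\<close>

text \<open>The three replacements stripped of the surrounding walk, so that context and replacement
  can be treated separately.\<close>

definition hmove :: "('a \<Rightarrow> 'a \<Rightarrow> bool) \<Rightarrow> 'a list \<Rightarrow> 'a list \<Rightarrow> bool" where
  "hmove E m m' \<longleftrightarrow>
     (\<exists>x y. m = [x, y, x] \<and> m' = [x]) \<or>
     (\<exists>x y z. E x y \<and> E y z \<and> E x z \<and> m = [x, y, z] \<and> m' = [x, z]) \<or>
     (\<exists>x y z w. induced_square E x y z w \<and> m = [x, y, z] \<and> m' = [x, w, z])"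

lemma hstep_iff: "hstep E p q \<longleftrightarrow> (\<exists>a c m m'. hmove E m m' \<and> p = a @ m @ c \<and> q = a @ m' @ c)"
proof
  assume "hstep E p q"
  then show "\<exists>a c m m'. hmove E m m' \<and> p = a @ m @ c \<and> q = a @ m' @ c"
    unfolding hstep_def hmove_def by blast
next
  assume "\<exists>a c m m'. hmove E m m' \<and> p = a @ m @ c \<and> q = a @ m' @ c"
  then obtain a c m m' where "hmove E m m'" and e: "p = a @ m @ c" "q = a @ m' @ c" by blast
  then show "hstep E p q"
    unfolding hmove_def
  proof (elim disjE exE conjE)
    fix x y assume "m = [x, y, x]" "m' = [x]"
    then show ?thesis unfolding hstep_def e by blast
  next
    fix x y z assume "E x y" "E y z" "E x z" "m = [x, y, z]" "m' = [x, z]"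
    then show ?thesis unfolding hstep_def e by blast
  next
    fix x y z w assume "induced_square E x y z w" "m = [x, y, z]" "m' = [x, w, z]"
    then show ?thesis unfolding hstep_def e by blast
  qed
qed

lemma hmove_ends: "hmove E m m' \<Longrightarrow> m \<noteq> [] \<and> m' \<noteq> [] \<and> hd m = hd m' \<and> last m = last m'"
  unfolding hmove_def by auto

lemma hstep_obtain:
  assumes "hstep E p q"
  obtains a c m m' where "hmove E m m'" "p = a @ m @ c" "q = a @ m' @ c"
  using assms unfolding hstep_iff by blast

lemma hstep_last: "hstep E p q \<Longrightarrow> last p = last q"
  by (elim hstep_obtain, drule hmove_ends) (simp add: last_append)

lemma hstep_context:
  assumes "hstep E p q" shows "hstep E (l @ p @ r) (l @ q @ r)"
proof -
  obtain a c m m' where "hmove E m m'" and e: "p = a @ m @ c" "q = a @ m' @ c"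
    using assms by (rule hstep_obtain)
  moreover have "l @ p @ r = (l @ a) @ m @ (c @ r)" "l @ q @ r = (l @ a) @ m' @ (c @ r)"
    using e by simp_all
  ultimately show ?thesis unfolding hstep_iff by blast
qed

lemma homotopic_refl: "homotopic V E p p"
  by (simp add: homotopic_def)

lemma homotopic_trans: "homotopic V E p q \<Longrightarrow> homotopic V E q r \<Longrightarrow> homotopic V E p r"
  unfolding homotopic_def by (rule rtranclp_trans)

lemma homotopic_sym: "homotopic V E p q \<Longrightarrow> homotopic V E q p"
  unfolding homotopic_def
proof (induction rule: rtranclp_induct)
  case (step q r)
  then show ?case by (intro converse_rtranclp_into_rtranclp[OF _ step.IH]) blast
qed simp

lemma homotopic_step:
  "walk V E p \<Longrightarrow> walk V E q \<Longrightarrow> hstep E p q \<or> hstep E q p \<Longrightarrow> homotopic V E p q"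
  unfolding homotopic_def by (simp add: r_into_rtranclp)

lemma homotopic_ends: "homotopic V E p q \<Longrightarrow> hd p = hd q \<and> last p = last q \<and> (walk V E p \<longleftrightarrow> walk V E q)"
  unfolding homotopic_def
proof (induction rule: rtranclp_induct)
  case (step q r)
  then show ?case using hstep_hd[of E q r] hstep_hd[of E r q] hstep_last[of E q r] hstep_last[of E r q] by auto
qed simp

text \<open>Serves for adding a fixed prefix or suffix. All intermediate images must be walks; the
  last hypothesis may rely on homotopies fixing both ends.\<close>

lemma homotopic_map:
  assumes "homotopic V E p q" "walk V E (f p)"
    and "\<And>p q. hstep E p q \<Longrightarrow> hstep E (f p) (f q)"
    and "\<And>p q. \<lbrakk>walk V E p; walk V E q; hd p = hd q; last p = last q; walk V E (f p)\<rbrakk> \<Longrightarrow> walk V E (f q)"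
  shows "homotopic V E (f p) (f q)"
proof -
  have "homotopic V E (f p) (f q) \<and> walk V E (f q)"
    using assms(1) unfolding homotopic_def
  proof (induction rule: rtranclp_induct)
    case (step q r)
    then have "hd q = hd r" "last q = last r" using hstep_hd hstep_last by metis+
    then have "walk V E (f r)" using assms(4)[of q r] step by blast
    moreover from this have "homotopic V E (f q) (f r)"
      using homotopic_step[of V E "f q" "f r"] step assms(3)[of q r] assms(3)[of r q] by blast
    ultimately show ?case using step.IH unfolding homotopic_def by (meson rtranclp_trans)
  qed (use assms in simp)
  then show ?thesis by simp
qed

context cgraph
begin

lemma homotopic_append:
  assumes "homotopic V E p q" "walk V E (p @ r)" "p \<noteq> []"
  shows "homotopic V E (p @ r) (q @ r)"
proof (cases "r = []")
  case False
  have "p \<noteq> []" using assms by simp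
  show ?thesis
  proof (rule homotopic_map[where f="\<lambda>p. p @ r", OF assms(1,2)])
    show "hstep E (p @ r) (q @ r)" if "hstep E p q" for p q
      using hstep_context[OF that, of "[]" r] by simp
    show "walk V E (q @ r)"
      if "walk V E p" "walk V E q" "hd p = hd q" "last p = last q" "walk V E (p @ r)" for p q
    proof -
      have "p \<noteq> []" "q \<noteq> []" using that by (simp_all add: walk_iff)
      then show ?thesis using that False by (simp add: walk_append)
    qed
  qed
qed (use assms in simp)

lemma homotopic_Cons:
  assumes "homotopic V E p q" "walk V E (x # p)"
  shows "homotopic V E (x # p) (x # q)"
proof (rule homotopic_map[where f="\<lambda>p. x # p", OF assms])
  show "hstep E (x # p) (x # q)" if "hstep E p q" for p q
    using hstep_context[OF that, of "[x]" "[]"] by simp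
  show "walk V E (x # q)" if "walk V E p" "walk V E q" "hd p = hd q" "walk V E (x # p)" for p q
    using that by (cases p; cases q) (auto simp: walk_iff)
qed

text \<open>Prepending the common first vertex \<open>y\<close> of \<open>p\<close> and
  \<open>q\<close> makes both walks start with \<open>y x y\<close>, and this backtrack can be
  removed.\<close>

lemma homotopic_Cons_cancel:
  assumes "homotopic V E (x # p) (x # q)" "walk V E (x # p)" "walk V E (x # q)" "p \<noteq> []" "q \<noteq> []" "hd p = hd q"
  shows "homotopic V E p q"
proof -
  obtain y where y: "hd p = y" by simp
  have drop: "homotopic V E (y # x # p) p" if w: "walk V E (x # p)" "p \<noteq> []" "hd p = y" for p
  proof -
    obtain p' where p: "p = y # p'" using w by (cases p) auto
    have "E y x" using w p E_sym by simp
    then have "walk V E (y # x # p)" using w by simp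
    moreover have "hstep E (y # x # p) p"
      unfolding hstep_def p by (rule disjI1) (metis append_Cons append_Nil)
    moreover have "walk V E p" using w p by simp
    ultimately show ?thesis using homotopic_step by blast
  qed
  have "E y x" using assms y E_sym by (cases p) auto
  then have "homotopic V E (y # x # p) (y # x # q)"
    using homotopic_Cons[OF assms(1), of y] assms by simp
  then show ?thesis
    using drop[of p] drop[of q] assms y homotopic_sym homotopic_trans by metis
qed

lemma homotopic_cancel:
  "\<lbrakk>homotopic V E (w @ tl p) (w @ tl q); walk V E w; walk V E p; walk V E q; last w = hd p; last w = hd q\<rbrakk>
   \<Longrightarrow> homotopic V E p q"
proof (induction w)
  case Nil
  then show ?case by (simp add: walk_iff)
next
  case (Cons x w)
  have ne: "p \<noteq> []" "q \<noteq> []" using Cons.prems by (auto simp: walk_iff)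
  show ?case
  proof (cases w)
    case Nil
    have "x = hd p" "x = hd q" using Cons.prems Nil by simp_all
    then have "[x] @ tl p = p" "[x] @ tl q = q" using ne by (metis append_Cons append_Nil list.collapse)+
    then show ?thesis using Cons.prems Nil by simp
  next
    case (Cons y w')
    have j: "walk V E ((x # w) @ tl p)" "walk V E ((x # w) @ tl q)"
      using Cons.prems walk_join by blast+
    have "homotopic V E (w @ tl p) (w @ tl q)"
      using homotopic_Cons_cancel[of x "w @ tl p" "w @ tl q"] Cons.prems(1) j Cons by simp
    then show ?thesis using Cons.IH Cons.prems Cons by simp
  qed
qed

lemma walk_replace:
  assumes "walk V E (a @ m @ c)" "m \<noteq> []" "walk V E m'" "hd m' = hd m" "last m' = last m"
  shows "walk V E (a @ m' @ c)" "walk V E m"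
  using assms by (auto simp: walk_iff successively_append_iff hd_append)

end

section \<open>Coverings of triangle-square complexes\<close>

text \<open>A covering map expressed on the \<open>1\<close>-skeleton: edges lift uniquely, and a
  lifted path over all but one edge of a triangle or an induced square closes up.\<close>

locale covering = base: cgraph V E + cov: cgraph V' E'
  for V :: "'a set" and E :: "'a \<Rightarrow> 'a \<Rightarrow> bool" and V' :: "'c set" and E' :: "'c \<Rightarrow> 'c \<Rightarrow> bool" +
  fixes proj :: "'c \<Rightarrow> 'a"
  assumes proj_edge: "E' X Y \<Longrightarrow> E (proj X) (proj Y)"
    and lift_edge: "\<lbrakk>X \<in> V'; E (proj X) y\<rbrakk> \<Longrightarrow> \<exists>Y. E' X Y \<and> proj Y = y"
    and lift_unique: "\<lbrakk>E' X Y; E' X Z; proj Y = proj Z\<rbrakk> \<Longrightarrow> Y = Z"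
    and lift_triangle: "\<lbrakk>E' X Y; E' Y Z; E (proj X) (proj Z)\<rbrakk> \<Longrightarrow> E' X Z"
    and lift_square: "\<lbrakk>E' X Y; E' Y Z; E' X W; induced_square E (proj X) (proj Y) (proj Z) (proj W)\<rbrakk>
      \<Longrightarrow> E' W Z"
begin

lemma far2_proj: "far2 E' X Y \<Longrightarrow> far2 E (proj X) (proj Y)"
proof -
  assume XY: "far2 E' X Y"
  then obtain C where C: "E' X C" "E' C Y" unfolding far2_def by blast
  have "proj X \<noteq> proj Y"
    using lift_unique[OF cov.E_sym[OF C(1)] C(2)] XY unfolding far2_def by blast
  moreover have "\<not> E (proj X) (proj Y)" using lift_triangle[OF C] XY unfolding far2_def by blast
  ultimately show ?thesis using C[THEN proj_edge] unfolding far2_def by blast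
qed

text \<open>\<open>x\<close> is lifted from \<open>X\<close> and compared with the image of a common
  neighbour \<open>C\<close> of \<open>X\<close> and \<open>Y\<close>. Equality, two triangles or an
  induced square shows that the lift also reaches \<open>Y\<close>.\<close>

lemma lift_common:
  assumes "far2 E' X Y" "E x (proj X)" "E x (proj Y)"
  shows "\<exists>Z. proj Z = x \<and> E' Z X \<and> E' Z Y"
proof -
  obtain C where C: "E' X C" "E' C Y" using assms unfolding far2_def by blast
  obtain Z where Z: "E' X Z" "proj Z = x"
    using lift_edge[of X x] cov.E_V[OF C(1)] assms base.E_sym by blast
  note far = far2_proj[OF assms(1)]
  have E: "E (proj X) (proj C)" "E (proj C) (proj Y)" using C proj_edge by blast+
  have "E' Z Y"
  proof -
    consider "x = proj C" | "E x (proj C)" | "x \<noteq> proj C" "\<not> E x (proj C)" by blast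
    then show ?thesis
    proof cases
      case 1
      then show ?thesis using lift_unique[OF Z(1) C(1)] Z C by simp
    next
      case 2
      then have "E' Z C" using lift_triangle[OF cov.E_sym[OF Z(1)] C(1)] Z by simp
      then show ?thesis using lift_triangle[of Z C Y] C Z assms by simp
    next
      case 3
      have "distinct [proj X, proj C, proj Y, x]"
        using 3 E assms far base.E_irrefl unfolding far2_def by auto
      moreover have "\<not> E (proj C) x" using 3 base.E_sym by blast
      moreover have "E (proj Y) x" using assms base.E_sym by blast
      ultimately have "induced_square E (proj X) (proj C) (proj Y) (proj Z)"
        using E assms far Z unfolding far2_def induced_square_def by simp
      from lift_square[OF C Z(1) this] show ?thesis .
    qed
  qed
  then show ?thesis using Z cov.E_sym by blast
qed

lemma lift_common_three:
  assumes "far2 E' U X" "far2 E' U Y" "E x (proj U)" "E x (proj X)" "E x (proj Y)"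
  shows "\<exists>Z. proj Z = x \<and> E' Z U \<and> E' Z X \<and> E' Z Y"
proof -
  obtain Z where Z: "proj Z = x" "E' Z U" "E' Z X" using lift_common[OF assms(1,3,4)] by blast
  obtain W where W: "proj W = x" "E' W U" "E' W Y" using lift_common[OF assms(2,3,5)] by blast
  have "Z = W" using lift_unique Z W cov.E_sym by metis
  then show ?thesis using Z W by blast
qed

text \<open>Coverings can bring distant vertices together; the neighbour \<open>W\<close> of
  \<open>Z\<close> at distance 2 from \<open>U\<close> prevents it. If the images of
  \<open>U\<close> and \<open>Z\<close> had distance 2, the triangle condition would give a common
  neighbour also adjacent to the image of \<open>W\<close>, and this one lifts to a common neighbour
  of \<open>U\<close> and \<open>Z\<close>.\<close>

lemma beyond2_proj:
  assumes wm: "locally_wm E" and Z: "E' Z W" "far2 E' U W" "beyond2 E' U Z"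
  shows "beyond2 E (proj U) (proj Z)"
proof -
  note far = far2_proj[OF Z(2)] and E = proj_edge[OF Z(1)]
  have ne: "proj U \<noteq> proj Z" using far E unfolding far2_def by auto
  have nE: "\<not> E (proj U) (proj Z)"
  proof
    assume "E (proj U) (proj Z)"
    then obtain X where "proj X = proj Z" "E' X U" "E' X W"
      using lift_common[OF Z(2)] E base.E_sym by blast
    then have "E' Z U" using lift_unique Z(1) cov.E_sym by metis
    then show False using Z(3) cov.E_sym unfolding beyond2_def by blast
  qed
  have "\<not> far2 E (proj U) (proj Z)"
  proof
    assume "far2 E (proj U) (proj Z)"
    then obtain x where x: "E x (proj U)" "E x (proj Z)" "E x (proj W)"
      using wm E far unfolding locally_wm_def by blast
    obtain X where X: "proj X = x" "E' X U" "E' X W" using lift_common[OF Z(2) x(1,3)] by blast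
    then have "E' X Z" using lift_triangle[OF X(3) cov.E_sym[OF Z(1)]] x by simp
    then show False using Z(3) X cov.E_sym unfolding beyond2_def by blast
  qed
  then show ?thesis using ne nE unfolding far2_def beyond2_def by blast
qed

lemma locally_wm_lift:
  assumes "locally_wm E" shows "locally_wm E'"
  unfolding locally_wm_def
proof (intro conjI allI impI)
  fix U X Y assume h: "E' X Y" "far2 E' U X" "far2 E' U Y"
  then obtain x where "E x (proj U)" "E x (proj X)" "E x (proj Y)"
    using assms proj_edge far2_proj unfolding locally_wm_def by metis
  then show "\<exists>Z. E' Z U \<and> E' Z X \<and> E' Z Y" using lift_common_three[OF h(2,3)] by blast
next
  fix U X Y Z
  assume h: "E' Z X" "E' Z Y" "far2 E' X Y" "far2 E' U X" "far2 E' U Y" "beyond2 E' U Z"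
  have "beyond2 E (proj U) (proj Z)" using beyond2_proj[OF assms h(1,4,6)] .
  then obtain x where "E x (proj U)" "E x (proj X)" "E x (proj Y)"
    using assms proj_edge[OF h(1)] proj_edge[OF h(2)] far2_proj[OF h(3)] far2_proj[OF h(4)] far2_proj[OF h(5)]
    unfolding locally_wm_def by blast
  then show "\<exists>W. E' W U \<and> E' W X \<and> E' W Y" using lift_common_three[OF h(4,5)] by blast
qed


lemma lift_walk_unique:
  "\<lbrakk>walk V' E' P; walk V' E' Q; hd P = hd Q; map proj P = map proj Q\<rbrakk> \<Longrightarrow> P = Q"
proof (induction P arbitrary: Q)
  case (Cons X P)
  then obtain Q' where Q: "Q = X # Q'" by (cases Q) auto
  show ?case
  proof (cases P)
    case Nil
    then show ?thesis using Cons Q by simp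
  next
    case (Cons Y P')
    then obtain Z Q'' where Q': "Q' = Z # Q''" using Cons.prems Q by (cases Q') auto
    have "Y = Z" using Cons.prems Cons Q Q' lift_unique by auto
    then show ?thesis using Cons.IH[of Q'] Cons.prems Cons Q Q' by simp
  qed
qed simp

text \<open>Both ends of the lifted piece are preserved, so it can be spliced back into the
  surrounding walk.\<close>

lemma lift_hmove:
  assumes "walk V' E' M" "walk V E m'" "hmove E (map proj M) m' \<or> hmove E m' (map proj M)"
  shows "\<exists>M'. walk V' E' M' \<and> map proj M' = m' \<and> hd M' = hd M \<and> last M' = last M \<and>
    (hmove E' M M' \<or> hmove E' M' M)"
proof -
  have square: ?thesis if "map proj M = [x, y, z]" "m' = [x, w, z]" "induced_square E x y z w" for x y z w
  proof -
    obtain X Y Z where M: "M = [X, Y, Z]" "x = proj X" "y = proj Y" "z = proj Z"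
      using \<open>map proj M = [x, y, z]\<close> by (auto simp: map_eq_Cons_conv)
    have XYZ: "E' X Y" "E' Y Z" "X \<in> V'" using assms(1) M cov.E_V by auto
    have "E x w" using that(3) base.E_sym unfolding induced_square_def by blast
    then obtain W where W: "E' X W" "proj W = w" using lift_edge XYZ M by blast
    have "E' W Z" using lift_square[OF XYZ(1,2) W(1)] M W that(3) by simp
    moreover have "\<not> E' X Z" "\<not> E' Y W"
      using that(3) M W proj_edge unfolding induced_square_def by blast+
    moreover have "distinct [X, Y, Z, W]" using that(3) M W unfolding induced_square_def by auto
    ultimately have "induced_square E' X Y Z W"
      using XYZ W cov.E_sym unfolding induced_square_def by blast
    moreover have "walk V' E' [X, W, Z]" using W \<open>E' W Z\<close> cov.E_V by simp
    ultimately show ?thesis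
      using M W that unfolding hmove_def by (intro exI[of _ "[X, W, Z]"]) auto
  qed
  from assms(3) show ?thesis
  proof
    assume "hmove E (map proj M) m'"
    from this[unfolded hmove_def] show ?thesis
    proof (elim disjE exE conjE)
      fix x y assume m: "map proj M = [x, y, x]" "m' = [x]"
      obtain X Y Z where M: "M = [X, Y, Z]" "x = proj X" "proj Y = y" "x = proj Z"
        using m by (auto simp: map_eq_Cons_conv)
      then have "E' Y X" "E' Y Z" using assms(1) cov.E_sym by auto
      then have "X = Z" using lift_unique M by metis
      then show ?thesis
        using M m cov.E_V[OF \<open>E' Y X\<close>] unfolding hmove_def by (intro exI[of _ "[X]"]) auto
    next
      fix x y z assume m: "E x z" "map proj M = [x, y, z]" "m' = [x, z]"
      obtain X Y Z where M: "M = [X, Y, Z]" "x = proj X" "proj Y = y" "z = proj Z"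
        using m(2) by (auto simp: map_eq_Cons_conv)
      then have "E' X Y" "E' Y Z" using assms(1) by auto
      moreover from this have "E' X Z" using lift_triangle M m(1) by blast
      ultimately show ?thesis
        using M m cov.E_V[of X Z] unfolding hmove_def by (intro exI[of _ "[X, Z]"]) auto
    next
      fix x y z w assume h: "induced_square E x y z w" "map proj M = [x, y, z]" "m' = [x, w, z]"
      from square[OF h(2,3,1)] show ?thesis .
    qed
  next
    assume "hmove E m' (map proj M)"
    from this[unfolded hmove_def] show ?thesis
    proof (elim disjE exE conjE)
      fix x y assume m: "m' = [x, y, x]" "map proj M = [x]"
      obtain X where M: "M = [X]" "x = proj X" using m by (auto simp: map_eq_Cons_conv)
      have "E x y" using assms(2) m by simp
      then obtain Y where "E' X Y" "proj Y = y" using lift_edge[of X y] M assms(1) by auto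
      then show ?thesis
        using M m cov.E_sym cov.E_V[of X Y] unfolding hmove_def by (intro exI[of _ "[X, Y, X]"]) auto
    next
      fix x y z assume m: "E x y" "E y z" "m' = [x, y, z]" "map proj M = [x, z]"
      obtain X Z where M: "M = [X, Z]" "x = proj X" "z = proj Z"
        using m(4) by (auto simp: map_eq_Cons_conv)
      then have XZ: "E' X Z" using assms(1) by auto
      obtain Y where Y: "E' X Y" "proj Y = y" using lift_edge[of X y] M m(1) cov.E_V[OF XZ] by auto
      have "E' Y Z" using lift_triangle[OF cov.E_sym[OF Y(1)] XZ] Y M m by blast
      then show ?thesis
        using M m XZ Y cov.E_V[of Y Z] unfolding hmove_def by (intro exI[of _ "[X, Y, Z]"]) auto
    next
      fix x y z w assume h: "induced_square E x y z w" "m' = [x, y, z]" "map proj M = [x, w, z]"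
      from square[OF h(3,2) induced_square_flip[OF h(1) base.E_sym]] show ?thesis .
    qed
  qed
qed

lemma lift_hstep:
  assumes "walk V' E' P" "walk V E q" "hstep E (map proj P) q \<or> hstep E q (map proj P)"
  shows "\<exists>Q. walk V' E' Q \<and> map proj Q = q \<and> hd Q = hd P \<and> (hstep E' P Q \<or> hstep E' Q P)"
proof -
  obtain a c m m' where m: "map proj P = a @ m @ c" "q = a @ m' @ c" "hmove E m m' \<or> hmove E m' m"
    using assms(3) unfolding hstep_iff by metis
  obtain A M C where P: "P = A @ M @ C" and M: "a = map proj A" "m = map proj M" "c = map proj C"
    using m(1) by (metis map_eq_append_conv)
  have ne: "m \<noteq> []" "m' \<noteq> []" "hd m = hd m'" "last m = last m'" using hmove_ends m(3) by metis+
  have "walk V E m'" using assms(2) m(2) ne by (auto simp: base.walk_iff successively_append_iff)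
  moreover have "walk V' E' M" using assms(1) P M ne by (auto simp: cov.walk_iff successively_append_iff)
  ultimately obtain M' where M': "walk V' E' M'" "map proj M' = m'" "hd M' = hd M" "last M' = last M"
      "hmove E' M M' \<or> hmove E' M' M"
    using lift_hmove[of M m'] m(3) M by blast
  have neM: "M \<noteq> []" "M' \<noteq> []" using ne M M' by auto
  have "walk V' E' (A @ M' @ C)"
    using cov.walk_replace(1)[OF _ neM(1) M'(1,3,4)] assms(1) P by blast
  moreover have "map proj (A @ M' @ C) = q" using m(2) M M' by simp
  moreover have "hd (A @ M' @ C) = hd P" using P M' neM by (simp add: hd_append)
  moreover have "hstep E' P (A @ M' @ C) \<or> hstep E' (A @ M' @ C) P"
    using M'(5) P unfolding hstep_iff by metis
  ultimately show ?thesis by blast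
qed

lemma lift_homotopic:
  assumes "homotopic V E p q" "walk V' E' P" "map proj P = p"
  shows "\<exists>Q. walk V' E' Q \<and> map proj Q = q \<and> hd Q = hd P \<and> homotopic V' E' P Q"
  using assms(1) unfolding homotopic_def[of V E]
proof (induction rule: rtranclp_induct)
  case base
  then show ?case using assms homotopic_refl by blast
next
  case (step q r)
  then obtain Q where Q: "walk V' E' Q" "map proj Q = q" "hd Q = hd P" "homotopic V' E' P Q" by blast
  obtain R where "walk V' E' R" "map proj R = r" "hd R = hd Q" "hstep E' Q R \<or> hstep E' R Q"
    using lift_hstep[OF Q(1), of r] step.hyps(2) Q(2) by blast
  then show ?case using Q homotopic_step homotopic_trans by metis
qed

text \<open>Testing at one vertex \<open>B\<close> suffices: a walk \<open>W\<close> from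
  \<open>B\<close> is put in front, the homotopy of the projections is lifted, its final walk is
  identified by unique lifting, and \<open>W\<close> is cancelled.\<close>

lemma simply_connected_cover:
  assumes B: "B \<in> V'"
    and loops: "\<And>P Q. \<lbrakk>walk V' E' P; walk V' E' Q; hd P = B; hd Q = B; last P = last Q\<rbrakk>
      \<Longrightarrow> homotopic V E (map proj P) (map proj Q)"
  shows cov.simply_connected
  unfolding cov.simply_connected_def
proof (intro allI impI)
  fix P Q assume PQ: "walk V' E' P" "walk V' E' Q" "hd P = hd Q" "last P = last Q"
  have "hd P \<in> V'" using PQ(1) by (auto simp: cov.walk_iff)
  then obtain W where W: "walk V' E' W" "hd W = B" "last W = hd P" using cov.dist_walk[OF B] by blast
  have WQ: "last W = hd Q" using W PQ by simp
  note P' = cov.walk_join[OF W(1) PQ(1) W(3)] and Q' = cov.walk_join[OF W(1) PQ(2) WQ]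
  have "homotopic V E (map proj (W @ tl P)) (map proj (W @ tl Q))"
    using loops[OF P'(1) Q'(1)] P' Q' W PQ by simp
  then obtain R where R: "walk V' E' R" "map proj R = map proj (W @ tl Q)" "hd R = hd (W @ tl P)"
      "homotopic V' E' (W @ tl P) R"
    using lift_homotopic[OF _ P'(1) refl] by blast
  have "R = W @ tl Q" using lift_walk_unique[OF R(1) Q'(1)] R P' Q' by simp
  then show "homotopic V' E' P Q"
    using cov.homotopic_cancel[OF _ W(1) PQ(1,2) W(3) WQ] R by simp
qed

end

lemma connected_graphI:
  assumes g: "graph V E" and b: "b \<in> V" and reach: "\<And>v. v \<in> V \<Longrightarrow> E\<^sup>*\<^sup>* b v"
  shows "connected_graph V E"
proof -
  have ex: "\<exists>xs. walk V E xs \<and> hd xs = u \<and> last xs = v" if "E\<^sup>*\<^sup>* u v" "u \<in> V" for u v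
    using that(1)
  proof (induction rule: rtranclp_induct)
    case base
    show ?case using that by (intro exI[of _ "[u]"]) (simp add: walk_def)
  next
    case (step v w)
    then obtain xs where xs: "walk V E xs" "hd xs = u" "last xs = v" by blast
    have "w \<in> V" using step g unfolding graph_def by blast
    then have "walk V E (xs @ [w])"
      using xs step unfolding walk_def successively_conv_nth[symmetric]
      by (auto simp: successively_append_iff)
    then show ?case using xs by (intro exI[of _ "xs @ [w]"]) (auto simp: walk_def)
  qed
  have sym: "E\<^sup>*\<^sup>* v u" if "E\<^sup>*\<^sup>* u v" for u v
    using that
    by (induction rule: rtranclp_induct)
      (use g in \<open>auto simp: graph_def intro: converse_rtranclp_into_rtranclp\<close>)
  have "\<exists>xs. walk V E xs \<and> hd xs = u \<and> last xs = v" if "u \<in> V" "v \<in> V" for u v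
    by (rule ex[OF rtranclp_trans[OF sym[OF reach[OF that(1)]] reach[OF that(2)]] that(1)])
  then show ?thesis
    unfolding connected_graph_def using g b by blast
qed

section \<open>The universal cover\<close>

context cgraph
begin

text \<open>The interval consists of \<open>u\<close>, \<open>v\<close> and their common neighbours,
  so the square may pass through \<open>u\<close> or \<open>v\<close>. One of its diagonals avoids
  both, and its ends are the required pair.\<close>

lemma far2_thick:
  assumes "thick V E" "far2 E u v"
  shows "\<exists>x y. far2 E x y \<and> E u x \<and> E x v \<and> E u y \<and> E y v"
proof -
  have V: "u \<in> V" "v \<in> V" using far2_V assms by blast+
  have d: "d u v = 2" using dist_2 V assms by blast
  obtain p q r s where pqrs: "{p, q, r, s} \<subseteq> I u v" "induced_square E p q r s"
    using assms(1) V d unfolding thick_def by blast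
  have I: "x = u \<or> x = v \<or> (E u x \<and> E x v)" if "x \<in> I u v" for x
  proof -
    have x: "x \<in> V" "d u x + d x v = 2" using that d unfolding interval_def by auto
    then consider "d u x = 0" | "d x v = 0" | "d u x = 1" "d x v = 1" by linarith
    then show ?thesis using dist_0 dist_1 V x(1) by cases auto
  qed
  have mid: "far2 E x y \<and> E u x \<and> E x v \<and> E u y \<and> E y v"
    if "E u x" "E x v" "E u y" "E y v" "x \<noteq> y" "\<not> E x y" for x y
    using that E_sym unfolding far2_def by blast
  have sq: "distinct [p, q, r, s]" "E p q" "E q r" "E r s" "E s p" "\<not> E p r" "\<not> E q s"
    using pqrs(2) unfolding induced_square_def by auto
  have ends: "\<exists>x y. far2 E x y \<and> E u x \<and> E x v \<and> E u y \<and> E y v"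
    if "p = u \<or> p = v \<or> r = u \<or> r = v"
  proof -
    have ne: "q \<noteq> u" "q \<noteq> v" "s \<noteq> u" "s \<noteq> v"
      using that sq I[of p] I[of r] pqrs(1) E_sym E_irrefl by auto
    then show ?thesis using mid[of q s] sq I[of q] I[of s] pqrs(1) by auto
  qed
  show ?thesis
  proof (cases "p = u \<or> p = v \<or> r = u \<or> r = v")
    case True
    then show ?thesis by (rule ends)
  next
    case False
    then show ?thesis using mid[of p r] sq I[of p] I[of r] pqrs(1) by auto
  qed
qed

lemma locally_dual_polar_props:
  assumes "locally_dual_polar V E"
  shows "locally_wm E"
    and "far2 E u v \<Longrightarrow> \<exists>x y. far2 E x y \<and> E u x \<and> E x v \<and> E u y \<and> E y v"
    and "\<lbrakk>E a c; E a e; E b c; E b e; E c e; a \<noteq> b\<rbrakk> \<Longrightarrow> E a b"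
    and "\<lbrakk>E a1 b2; E a1 b3; E a2 b1; E a2 b2; E a2 b3; E a3 b1; E a3 b2; E a3 b3;
       beyond2 E a1 b1; far2 E a1 a2; far2 E a1 a3; far2 E a2 a3; far2 E b1 b2; far2 E b1 b3; far2 E b2 b3\<rbrakk> \<Longrightarrow> False"
proof -
  show "locally_wm E" using assms locally_wm unfolding locally_dual_polar_def by blast
  show "far2 E u v \<Longrightarrow> \<exists>x y. far2 E x y \<and> E u x \<and> E x v \<and> E u y \<and> E y v"
    using assms far2_thick unfolding locally_dual_polar_def by blast
  show "E a b" if h: "E a c" "E a e" "E b c" "E b e" "E c e" "a \<noteq> b"
  proof (rule ccontr)
    assume "\<not> E a b"
    moreover have "distinct [a, b, c, e]" using h E_neq by auto
    ultimately have "has_induced_K4_minus V E"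
      unfolding has_induced_K4_minus_def using h E_V by blast
    then show False using assms unfolding locally_dual_polar_def by blast
  qed
  show False if h: "E a1 b2" "E a1 b3" "E a2 b1" "E a2 b2" "E a2 b3" "E a3 b1" "E a3 b2" "E a3 b3"
       "beyond2 E a1 b1" "far2 E a1 a2" "far2 E a1 a3" "far2 E a2 a3" "far2 E b1 b2" "far2 E b1 b3" "far2 E b2 b3"
  proof -
    have V: "a1 \<in> V" "a2 \<in> V" "a3 \<in> V" "b1 \<in> V" "b2 \<in> V" "b3 \<in> V"
      using h E_V by blast+
    have d2: "d a1 a2 = 2" "d a1 a3 = 2" "d a2 a3 = 2" "d b1 b2 = 2" "d b1 b3 = 2" "d b2 b3 = 2"
      using dist_2 V h by blast+
    have d3: "d a1 b1 = 3"
      using dist_ge_3[OF V(1,4)] dist_step[OF V(1) h(3)] d2(1) h(9) by simp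
    have "distinct [a1, a2, a3, b1, b2, b3]"
      using h E_neq unfolding far2_def beyond2_def by auto
    then have "has_isometric_K33_minus V E"
      unfolding has_isometric_K33_minus_def
      by (intro bexI[OF _ V(1)] bexI[OF _ V(2)] bexI[OF _ V(3)] bexI[OF _ V(4)] bexI[OF _ V(5)] bexI[OF _ V(6)])
        (simp add: h d2 d3)
    then show False using assms unfolding locally_dual_polar_def by blast
  qed
qed

section \<open>Homotopy classes of walks and their adjacency\<close>

lemma homotopic_snoc:
  assumes "homotopic V E p q" "walk V E p" "E (last p) v"
  shows "homotopic V E (p @ [v]) (q @ [v])"
proof -
  have "p \<noteq> []" using assms by (simp add: walk_iff)
  moreover have "walk V E (p @ [v])" using assms E_V \<open>p \<noteq> []\<close> by (simp add: walk_append)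
  ultimately show ?thesis using homotopic_append assms by blast
qed

lemma walk_snoc: "walk V E p \<Longrightarrow> E (last p) v \<Longrightarrow> walk V E (p @ [v])"
  using E_V(2)[of "last p" v] walk_append[of p "[v]"] by (cases "p = []") (simp_all add: walk_iff)

abbreviation hclass :: "'a list \<Rightarrow> 'a list set" where
  "hclass p \<equiv> {q. homotopic V E p q}"

lemma hclass_eq: "hclass p = hclass q \<longleftrightarrow> homotopic V E p q"
proof
  assume "hclass p = hclass q"
  then have "q \<in> hclass p" using homotopic_refl[of V E q] by simp
  then show "homotopic V E p q" by simp
next
  assume h: "homotopic V E p q"
  show "hclass p = hclass q"
    using homotopic_trans[OF h] homotopic_trans[OF homotopic_sym[OF h]] by blast
qed

lemma hclass_mem: "q \<in> hclass p \<Longrightarrow> hclass p = hclass q"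
  using hclass_eq by simp

text \<open>The covering projection. Homotopies fix the last vertex, so the choice does not
  matter.\<close>

definition endpoint :: "'a list set \<Rightarrow> 'a" where
  "endpoint C = last (SOME p. p \<in> C)"

lemma endpoint_hclass [simp]: "endpoint (hclass p) = last p"
proof -
  have "(SOME q. q \<in> hclass p) \<in> hclass p" by (rule someI[of _ p]) (simp add: homotopic_refl)
  then show ?thesis unfolding endpoint_def using homotopic_ends by fastforce
qed

lemma cover_V_obtain:
  assumes "C \<in> cover_V V E b"
  obtains p where "C = hclass p" "walk V E p" "hd p = b"
  using assms unfolding cover_V_def by blast

lemma cover_V_I: "walk V E p \<Longrightarrow> hd p = b \<Longrightarrow> hclass p \<in> cover_V V E b"
  unfolding cover_V_def by blast

lemma hclass_backtrack:
  assumes "walk V E p" "E (last p) v"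
  shows "hclass (p @ [v] @ [last p]) = hclass p"
proof -
  have p: "p = butlast p @ [last p]" using assms by (simp add: walk_iff)
  have w: "walk V E (p @ [v])" using walk_snoc assms by blast
  have "walk V E ((p @ [v]) @ [last p])" using walk_snoc[OF w] assms E_sym by simp
  moreover have "hstep E (p @ [v] @ [last p]) p"
  proof -
    have "p @ [v] @ [last p] = butlast p @ [last p, v, last p] @ []" "p = butlast p @ [last p] @ []"
      using p by (metis append.assoc append_Cons append_Nil append_Nil2)+
    then show ?thesis unfolding hstep_def by blast
  qed
  ultimately show ?thesis using homotopic_step[of V E "p @ [v] @ [last p]" p] assms hclass_eq by simp
qed

text \<open>Edges may be witnessed from either class and by any representative. A backtrack reverses
  a witness from the other class, so one representative extended by one vertex describes all
  neighbours.\<close>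

lemma cover_E_iff:
  assumes "walk V E p" "hd p = b"
  shows "cover_E V E b (hclass p) D \<longleftrightarrow> (\<exists>v. E (last p) v \<and> D = hclass (p @ [v]))"
proof
  assume "\<exists>v. E (last p) v \<and> D = hclass (p @ [v])"
  then obtain v where v: "E (last p) v" "D = hclass (p @ [v])" by blast
  have "hd (p @ [v]) = b" using assms by (simp add: walk_iff)
  then have "D \<in> cover_V V E b" using cover_V_I walk_snoc[OF assms(1) v(1)] v(2) by blast
  then show "cover_E V E b (hclass p) D"
    unfolding cover_E_def using cover_V_I[OF assms] v homotopic_refl by blast
next
  assume a: "cover_E V E b (hclass p) D"
  have D: "D \<in> cover_V V E b" using a by (simp add: cover_E_def)
  from a consider q v where "q \<in> hclass p" "E (last q) v" "q @ [v] \<in> D"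
    | q v where "q \<in> D" "E (last q) v" "q @ [v] \<in> hclass p"
    unfolding cover_E_def by blast
  then show "\<exists>v. E (last p) v \<and> D = hclass (p @ [v])"
  proof cases
    case 1
    then have q: "homotopic V E p q" by simp
    then have l: "E (last p) v" using 1 homotopic_ends by metis
    have "D = hclass (q @ [v])" using 1(3) D cover_V_obtain hclass_mem by metis
    also have "\<dots> = hclass (p @ [v])" using homotopic_snoc[OF q assms(1) l] hclass_eq by blast
    finally show ?thesis using l by blast
  next
    case 2
    have Dq: "D = hclass q" using 2(1) D cover_V_obtain hclass_mem by metis
    have h: "homotopic V E p (q @ [v])" using 2 by simp
    have l: "last p = v" using homotopic_ends[OF h] by simp
    have "q \<noteq> []"
    proof -
      obtain r where "D = hclass r" "walk V E r" using cover_V_obtain D by blast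
      then have "walk V E q" using 2(1) homotopic_ends by blast
      then show ?thesis by (simp add: walk_iff)
    qed
    have wq: "walk V E q"
      using homotopic_ends[OF h] assms(1) walk_append[OF \<open>q \<noteq> []\<close>, of "[v]"] by simp
    have e: "E (last p) (last q)" using l 2(2) E_sym by blast
    have "hclass (p @ [last q]) = hclass (q @ [v] @ [last q])"
      using homotopic_snoc[OF h assms(1) e] hclass_eq by simp
    also have "\<dots> = D" using hclass_backtrack[OF wq 2(2)] Dq by simp
    finally show ?thesis using e by blast
  qed
qed

end

section \<open>The cover with base point \<open>b\<close>\<close>

locale based_cover = cgraph +
  fixes b :: 'a
  assumes b: "b \<in> V"
begin

abbreviation "Vc \<equiv> cover_V V E b"
abbreviation "Ec \<equiv> cover_E V E b"

lemma Ec_obtain: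
  assumes "Ec C D"
  obtains p where "walk V E p" "hd p = b" "C = hclass p" "E (last p) (endpoint D)"
    "D = hclass (p @ [endpoint D])"
proof -
  obtain p where p: "C = hclass p" "walk V E p" "hd p = b"
    using assms cover_V_obtain unfolding cover_E_def by blast
  then obtain v where "E (last p) v" "D = hclass (p @ [v])" using assms cover_E_iff by blast
  then show ?thesis using that p by simp
qed

lemma Ec_sym: "Ec C D \<Longrightarrow> Ec D C"
  unfolding cover_E_def by blast

lemma Ec_eq: "\<lbrakk>Ec C D; walk V E p; hd p = b; C = hclass p\<rbrakk> \<Longrightarrow> D = hclass (p @ [endpoint D])"
proof -
  assume a: "Ec C D" "walk V E p" "hd p = b" "C = hclass p"
  then obtain v where "D = hclass (p @ [v])" using cover_E_iff[OF a(2,3)] by blast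
  then show ?thesis by simp
qed

lemma cover_connected: "connected_graph Vc Ec"
proof (rule connected_graphI)
  show "graph Vc Ec"
    unfolding graph_def
  proof (intro allI impI conjI)
    fix C D assume CD: "Ec C D"
    show "C \<in> Vc" "D \<in> Vc" using CD by (simp_all add: cover_E_def)
    show "Ec D C" using Ec_sym CD .
    obtain p where "C = hclass p" "E (last p) (endpoint D)" using CD by (rule Ec_obtain)
    then have "E (endpoint C) (endpoint D)" by simp
    then show "C \<noteq> D" using E_irrefl by metis
  qed
  show "hclass [b] \<in> Vc" using cover_V_I[of "[b]" b] b by simp
  fix C assume "C \<in> Vc"
  then obtain p where p: "C = hclass p" "walk V E p" "hd p = b" by (rule cover_V_obtain)
  have "Ec\<^sup>*\<^sup>* (hclass [b]) (hclass p)" using p(2,3)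
  proof (induction p rule: rev_induct)
    case (snoc v p)
    show ?case
    proof (cases "p = []")
      case False
      then have w: "walk V E p" "hd p = b" "E (last p) v" using snoc.prems walk_append[of p "[v]"] by auto
      then have "Ec (hclass p) (hclass (p @ [v]))" using cover_E_iff by blast
      then show ?thesis using snoc.IH w by (meson rtranclp.rtrancl_into_rtrancl)
    qed (use snoc in simp)
  qed (simp add: walk_iff)
  then show "Ec\<^sup>*\<^sup>* (hclass [b]) C" using p by simp
qed

text \<open>Triangles and squares close up because their moves are elementary homotopies: the two
  ways of extending a representative around the cell give one class.\<close>

sublocale covering V E Vc Ec endpoint
proof (intro covering.intro covering_axioms.intro cgraph.intro)
  show "connected_graph V E" by (rule conn)
  show "connected_graph Vc Ec" by (rule cover_connected)
  show "E (endpoint X) (endpoint Y)" if "Ec X Y" for X Y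
    using that by (rule Ec_obtain) simp
  show "\<exists>Y. Ec X Y \<and> endpoint Y = y" if "X \<in> Vc" "E (endpoint X) y" for X y
  proof -
    obtain p where p: "X = hclass p" "walk V E p" "hd p = b" using \<open>X \<in> Vc\<close> by (rule cover_V_obtain)
    then have "Ec X (hclass (p @ [y]))" using cover_E_iff[OF p(2,3)] \<open>E (endpoint X) y\<close> by auto
    then show ?thesis by (intro exI[of _ "hclass (p @ [y])"]) simp
  qed
  show "Y = Z" if h: "Ec X Y" "Ec X Z" "endpoint Y = endpoint Z" for X Y Z
  proof -
    obtain p where p: "walk V E p" "hd p = b" "X = hclass p" using h(1) by (rule Ec_obtain)
    show ?thesis using Ec_eq[OF h(1) p] Ec_eq[OF h(2) p] h(3) by simp
  qed
  show "Ec X Z" if h: "Ec X Y" "Ec Y Z" "E (endpoint X) (endpoint Z)" for X Y Z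
  proof -
    obtain p where p: "walk V E p" "hd p = b" "X = hclass p" "E (last p) (endpoint Y)"
      "Y = hclass (p @ [endpoint Y])" using h(1) by (rule Ec_obtain)
    let ?y = "endpoint Y" and ?z = "endpoint Z"
    have wy: "walk V E (p @ [?y])" "hd (p @ [?y]) = b"
      using walk_snoc p by (auto simp: walk_iff)
    then have Z: "Z = hclass ((p @ [?y]) @ [?z])" and yz: "E ?y ?z"
      using Ec_eq[OF h(2) wy p(5)] cover_E_iff[OF wy, of Z] h(2) p(5) by auto
    have xz: "E (last p) ?z" using h(3) p by simp
    have pe: "p = butlast p @ [last p]" using p by (simp add: walk_iff)
    have "hstep E ((p @ [?y]) @ [?z]) (p @ [?z])"
      unfolding hstep_iff
      by (intro exI[of _ "butlast p"] exI[of _ "[]"] exI[of _ "[last p, ?y, ?z]"] exI[of _ "[last p, ?z]"])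
        (use pe p(4) yz xz in \<open>auto simp: hmove_def\<close>)
    moreover have "walk V E ((p @ [?y]) @ [?z])" using walk_snoc[OF wy(1)] yz by simp
    moreover have "walk V E (p @ [?z])" using walk_snoc[OF p(1) xz] .
    ultimately have "Z = hclass (p @ [?z])" using homotopic_step hclass_eq Z by blast
    then show ?thesis using cover_E_iff p xz by blast
  qed
  show "Ec W Z" if h: "Ec X Y" "Ec Y Z" "Ec X W"
    "induced_square E (endpoint X) (endpoint Y) (endpoint Z) (endpoint W)" for X Y Z W
  proof -
    obtain p where p: "walk V E p" "hd p = b" "X = hclass p" "E (last p) (endpoint Y)"
      "Y = hclass (p @ [endpoint Y])" using h(1) by (rule Ec_obtain)
    let ?y = "endpoint Y" and ?z = "endpoint Z" and ?w = "endpoint W"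
    have sq: "induced_square E (last p) ?y ?z ?w" using h(4) p by simp
    then have E: "E ?y ?z" "E ?w ?z" "E (last p) ?w" using E_sym unfolding induced_square_def by blast+
    have wy: "walk V E (p @ [?y])" "hd (p @ [?y]) = b" "walk V E (p @ [?w])" "hd (p @ [?w]) = b"
      using walk_snoc p E by (auto simp: walk_iff)
    have Z: "Z = hclass ((p @ [?y]) @ [?z])" using Ec_eq[OF h(2) wy(1,2) p(5)] .
    have W: "W = hclass (p @ [?w])" using Ec_eq[OF h(3) p(1-3)] .
    have pe: "p = butlast p @ [last p]" using p by (simp add: walk_iff)
    have "hstep E ((p @ [?y]) @ [?z]) ((p @ [?w]) @ [?z])"
      unfolding hstep_iff
      by (intro exI[of _ "butlast p"] exI[of _ "[]"] exI[of _ "[last p, ?y, ?z]"] exI[of _ "[last p, ?w, ?z]"])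
        (use pe sq in \<open>auto simp: hmove_def\<close>)
    moreover have "walk V E ((p @ [?y]) @ [?z])" "walk V E ((p @ [?w]) @ [?z])"
      using walk_snoc[OF wy(1)] walk_snoc[OF wy(3)] E by simp_all
    ultimately have "Z = hclass ((p @ [?w]) @ [?z])" using homotopic_step hclass_eq Z by blast
    then show ?thesis using cover_E_iff[OF wy(3,4)] W E by fastforce
  qed
qed

text \<open>Walks upstairs from the trivial class record their own projection, so a common end means
  homotopic projections. This is what makes the cover simply connected.\<close>

lemma last_walk_cover:
  "\<lbrakk>walk Vc Ec P; hd P = hclass [b]\<rbrakk> \<Longrightarrow> last P = hclass (map endpoint P) \<and> walk V E (map endpoint P) \<and> hd (map endpoint P) = b"
proof (induction P rule: rev_induct)
  case (snoc D P)
  show ?case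
  proof (cases "P = []")
    case True
    then show ?thesis using snoc.prems b by simp
  next
    case False
    then have w: "walk Vc Ec P" "hd P = hclass [b]" "Ec (last P) D"
      using snoc.prems cov.walk_append[of P "[D]"] by auto
    then have IH: "last P = hclass (map endpoint P)" "walk V E (map endpoint P)" "hd (map endpoint P) = b"
      using snoc.IH by blast+
    have "D = hclass (map endpoint P @ [endpoint D])" using Ec_eq[OF w(3) IH(2,3,1)] .
    moreover have "E (last (map endpoint P)) (endpoint D)"
      using proj_edge[OF w(3)] False by (simp add: last_map)
    ultimately show ?thesis using walk_snoc[OF IH(2)] IH(3) False by (simp add: hd_append)
  qed
qed (simp add: cov.walk_iff)

lemma cover_simply_connected: cov.simply_connected
proof (rule simply_connected_cover)
  show "hclass [b] \<in> Vc" using cover_V_I[of "[b]" b] b by simp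
  fix P Q assume "walk Vc Ec P" "walk Vc Ec Q" "hd P = hclass [b]" "hd Q = hclass [b]" "last P = last Q"
  then show "homotopic V E (map endpoint P) (map endpoint Q)"
    using last_walk_cover hclass_eq by metis
qed

lemma cover_polar_graph:
  assumes "locally_dual_polar V E" shows "polar_graph Vc Ec"
proof (intro polar_graph.intro polar_graph_axioms.intro)
  note base = locally_dual_polar_props[OF assms]
  show "cgraph Vc Ec" ..
  note wm = locally_wm_lift[OF base(1)]
  show cov.TC cov.QC using cov.local_to_global[OF wm cover_simply_connected] .
  show "\<exists>X Y. far2 Ec X Y \<and> Ec U X \<and> Ec X W \<and> Ec U Y \<and> Ec Y W" if f: "far2 Ec U W" for U W
  proof -
    obtain x y where xy: "far2 E x y" "E (endpoint U) x" "E x (endpoint W)" "E (endpoint U) y" "E y (endpoint W)"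
      using base(2) far2_proj[OF f] by blast
    obtain X where X: "endpoint X = x" "Ec X U" "Ec X W" using lift_common[OF f] xy E_sym by blast
    obtain Y where Y: "endpoint Y = y" "Ec Y U" "Ec Y W" using lift_common[OF f] xy E_sym by blast
    have "far2 Ec X Y" using xy(1) X Y proj_edge Ec_sym unfolding far2_def by blast
    then show ?thesis using X Y Ec_sym by blast
  qed
  show "Ec A B" if h: "Ec A C" "Ec A D" "Ec B C" "Ec B D" "Ec C D" "A \<noteq> B" for A B C D
  proof -
    have "endpoint A \<noteq> endpoint B" using lift_unique h Ec_sym by metis
    then have "E (endpoint A) (endpoint B)"
      using base(3)[of "endpoint A" "endpoint C" "endpoint D" "endpoint B"] proj_edge h by blast
    then show ?thesis using lift_triangle[OF h(1) Ec_sym[OF h(3)]] by blast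
  qed
  show False if h: "Ec a1 b2" "Ec a1 b3" "Ec a2 b1" "Ec a2 b2" "Ec a2 b3" "Ec a3 b1" "Ec a3 b2" "Ec a3 b3"
       "beyond2 Ec a1 b1" "far2 Ec a1 a2" "far2 Ec a1 a3" "far2 Ec a2 a3" "far2 Ec b1 b2" "far2 Ec b1 b3" "far2 Ec b2 b3"
     for a1 a2 a3 b1 b2 b3
    \<comment> \<open>The nonadjacent pair \<open>a1\<close>, \<open>b1\<close> stays beyond
      distance 2 because \<open>a2\<close> is adjacent to \<open>b1\<close> and at distance 2 from
      \<open>a1\<close>, as \<open>beyond2_proj\<close> requires.\<close>
    by (rule base(4)[OF h(1-8)[THEN proj_edge] beyond2_proj[OF base(1) Ec_sym[OF h(3)] h(10,9)] h(10-15)[THEN far2_proj]])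
qed

lemma cover_locally_finite:
  assumes "locally_finite V E" shows "locally_finite Vc Ec"
  unfolding locally_finite_def
proof
  fix C assume "C \<in> Vc"
  then obtain p where p: "C = hclass p" "walk V E p" "hd p = b" by (rule cover_V_obtain)
  have "{D. Ec C D} \<subseteq> (\<lambda>v. hclass (p @ [v])) ` {v. E (last p) v}" using cover_E_iff p by blast
  moreover have "last p \<in> V" using p by (auto simp: walk_iff)
  ultimately show "finite {D. Ec C D}"
    using assms finite_subset unfolding locally_finite_def by blast
qed

end

theorem theorem5p3:
  fixes V :: "'a set" and E :: "'a \<Rightarrow> 'a \<Rightarrow> bool" and b :: 'a
  assumes "locally_dual_polar V E" and "b \<in> V"
  shows "dual_polar (cover_V V E b) (cover_E V E b) \<and>
         (locally_finite V E \<longrightarrow> finite (cover_V V E b))"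
proof -
  interpret based_cover V E b
    using assms by unfold_locales (auto simp: locally_dual_polar_def)
  interpret polar_graph Vc Ec by (rule cover_polar_graph[OF assms(1)])
  show ?thesis using dual_polar finite_if_locally_finite cover_locally_finite by blast
qed

end
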